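(* Let $V=(V,Y,\mathbf 1,\omega)$ be a vertex operator algebra over $\mathbb C$. Then for all $u_1,v_1,u_2,v_2\in V$, with $x_0,x_1,x_2,y_1,y_2,w_1,w_2$ commuting formal variables, $$\begin{aligned} &x_0^{-1}\delta\!\left(e^{w_{21}}\frac{e^{w_1}x_1}{x_0}\right)X(Y[u_1,y_1]v_1,e^{w_1}x_1)\,X(Y[u_2,y_2]v_2,e^{w_2}x_2)\\ &\quad-x_0^{-1}\delta\!\left(-e^{w_{12}}\frac{e^{w_2}x_2}{x_0}\right)X(Y[u_2,y_2]v_2,e^{w_2}x_2)\,X(Y[u_1,y_1]v_1,e^{w_1}x_1)\\ &=(e^{w_2}x_2)^{-1}\delta\!\left(e^{-w_{01}}\frac{e^{w_1}x_1}{e^{w_2}x_2}\right)X\bigl(Y[Y[u_1,y_1]v_1,w_{01}]\,Y[u_2,y_2]v_2,\;e^{w_2}x_2\bigr), \end{aligned}$$ where $$w_{21}=\log\left(1-\frac{e^{w_2}x_2}{e^{w_1}x_1}\right),\qquad w_{12}=\log\left(1-\frac{e^{w_1}x_1}{e^{w_2}x_2}\right),\qquad w_{01}=-\log\left(1-\frac{x_0}{e^{w_1}x_1}\right).$$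
   Context: A vertex operator algebra $(V,Y,\mathbf 1,\omega)$ over $\mathbb C$ is a $\mathbb Z$-graded vector space $V=\coprod_{n\in\mathbb Z}V_{(n)}$ (write $\mathrm{wt}\,v=n$ for $v\in V_{(n)}$) with $\dim V_{(n)}<\infty$ for all $n$ and $V_{(n)}=0$ for $n$ sufficiently small (i.e. sufficiently negative), a linear map $V\to(\mathrm{End}\,V)[[x,x^{-1}]]$, $v\mapsto Y(v,x)=\sum_{n\in\mathbb Z}v_nx^{-n-1}$, and homogeneous vectors $\mathbf 1\in V_{(0)}$, $\omega\in V_{(2)}$, such that for $u,v\in V$: $u_nv=0$ for $n$ sufficiently large; $Y(\mathbf 1,x)=1$; $Y(v,x)\mathbf 1\in V[[x]]$ with constant term $v$; the Jacobi identity $$x_0^{-1}\delta\!\left(\tfrac{x_1-x_2}{x_0}\right)Y(u,x_1)Y(v,x_2)-x_0^{-1}\delta\!\left(\tfrac{x_2-x_1}{-x_0}\right)Y(v,x_2)Y(u,x_1)=x_2^{-1}\delta\!\left(\tfrac{x_1-x_0}{x_2}\right)Y(Y(u,x_0)v,x_2)$$ holds (binomial expressions expanded in nonnegative powers of the second variable); writing $Y(\omega,x)=\sum_{n}L(n)x^{-n-2}$, one has $[L(m),L(n)]=(m-n)L(m+n)+\frac1{12}(m^3-m)\delta_{m+n,0}(\mathrm{rank}\,V)$ for some $\mathrm{rank}\,V\in\mathbb C$; $L(0)v=nv$ for $v\in V_{(n)}$; and $\frac{d}{dx}Y(v,x)=Y(L(-1)v,x)$. Here $\delta(x)=\sum_{n\in\mathbb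 Z}x^n$. For $v\in V$, $X(v,x)=Y(x^{L(0)}v,x)$, i.e. $X(v,x)=x^{\mathrm{wt}\,v}Y(v,x)$ for homogeneous $v$, extended linearly. For $u\in V$, $Y[u,y]=Y(e^{yL(0)}u,e^{y}-1)$, where powers $(e^y-1)^{n}$, $n\in\mathbb Z$, are expanded as formal Laurent series in $y$ with finitely many negative powers, so $Y[u,y]v\in V((y))$. The maps $X(\cdot,x)$ and $Y[\cdot,y]$ are extended coefficientwise to formal series with coefficients in $V$. Substituting $e^{w}x$ for $x$ means replacing $x^n$ by $e^{nw}x^n$ with $e^{nw}$ expanded in nonnegative powers of $w$. $\log(1-z)=-\sum_{n\ge1}z^n/n$ denotes the logarithmic formal series, so that $e^{w_{21}}=1-\frac{e^{w_2}x_2}{e^{w_1}x_1}$, $e^{w_{12}}=1-\frac{e^{w_1}x_1}{e^{w_2}x_2}$, $e^{-w_{01}}=1-\frac{x_0}{e^{w_1}x_1}$, and all integer powers of these are expanded by the binomial series in nonnegative powers of the second summand. $Y[\cdot,w_{01}]$ denotes the substitution of the series $w_{01}$ (in positive powers of $x_0$) for the variable $y$ in $Y[\cdot,y]$, negative powers of $w_{01}$ being expanded as Laurent series in $x_0$ with finitely many negative powers of $x_0$. *)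

theory Defs
  imports
    Complex_Main
    "HOL-Computational_Algebra.Formal_Laurent_Series"
    "HOL-Library.Groups_Big_Fun"
begin

section \<open>Formal series in several commuting variables\<close>

datatype fvar = X0 | X1 | X2 | Y1 | Y2 | W1 | W2

type_synonym mono = "fvar \<Rightarrow> int"

text \<open>
  A series is the family of its coefficients, indexed by the exponent vectors of the Laurent
  monomials; nothing is required of its support. Scalar series have \<open>'a = complex\<close>, series with
  coefficients in \<open>V\<close> have \<open>'a = 'v\<close>, and series with coefficients in \<open>End V\<close> have
  \<open>'a = 'v \<Rightarrow> 'v\<close>. Exponent vectors are subtracted pointwise.

  A coefficient of a product or of a substitution is a sum over an infinite index set with only
  finitely many nonzero terms (for operator series: after application to a fixed vector). It is
  written with \<^const>\<open>Sum_any\<close>, which is the sum of the nonzero terms and has the junk value 0 when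
  there are infinitely many of them. In a vertex operator algebra, all sums occurring in the
  Jacobi identity and in the operators on V built below from formal variables, exponentials and
  logarithms as in the text are finite. For a fixed exponent vector and a fixed vector of \<open>V\<close>
  they run over a single term where the factors involve disjoint variables; otherwise over
  exponents that are bounded below in both factors: in binomial expansions and in
  \<open>w\<^sub>1, w\<^sub>2\<close> these are nonnegative, and in vertex operators they are bounded below because
  \<open>u\<^sub>n v = 0\<close> for large \<open>n\<close>.
\<close>

type_synonym 'a fser = "mono \<Rightarrow> 'a"

definition fmono :: "fvar \<Rightarrow> int \<Rightarrow> complex fser" where
  "fmono x n = (\<lambda>m. if m = (\<lambda>_. 0)(x := n) then 1 else 0)"

text \<open>
  A series to be substituted for a variable is given by the family of its integer powers. Thus
  \<open>fmono x\<close> stands for the variable \<open>x\<close>, and \<open>emono x w\<close> for \<open>e\<^sup>w x\<close>, with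
  \<open>(e\<^sup>w x)\<^sup>n = e\<^sup>n\<^sup>w x\<^sup>n\<close> expanded in nonnegative powers of \<open>w\<close>.
\<close>

definition emono :: "fvar \<Rightarrow> fvar \<Rightarrow> int \<Rightarrow> complex fser" where
  "emono x w n = (\<lambda>m. if \<exists>a::nat. m = (\<lambda>_. 0)(x := n, w := int a)
                       then fps_nth (fps_exp (of_int n)) (nat (m w)) else 0)"

definition fmul :: "complex fser \<Rightarrow> complex fser \<Rightarrow> complex fser" (infixl \<open>\<star>\<close> 70) where
  "f \<star> g = (\<lambda>m. Sum_any (\<lambda>k. f k * g (m - k)))"

definition ratio :: "(int \<Rightarrow> complex fser) \<Rightarrow> (int \<Rightarrow> complex fser) \<Rightarrow> int \<Rightarrow> complex fser" where
  "ratio A B n = A n \<star> B (- n)"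

text \<open>The substitution of the series with powers \<open>Z\<close> for the variable of a Laurent series.\<close>

definition fsubst :: "complex fls \<Rightarrow> (int \<Rightarrow> complex fser) \<Rightarrow> complex fser" where
  "fsubst F Z = (\<lambda>m. Sum_any (\<lambda>n. fls_nth F n * Z n m))"

text \<open>\<open>(A - B)\<^sup>n\<close>, expanded in nonnegative powers of \<open>B\<close>.\<close>

definition fdiff :: "(int \<Rightarrow> complex fser) \<Rightarrow> (int \<Rightarrow> complex fser) \<Rightarrow> int \<Rightarrow> complex fser" where
  "fdiff A B n =
     (\<lambda>m. Sum_any (\<lambda>k::nat. (- 1) ^ k * (of_int n gchoose k) * (A (n - int k) \<star> B (int k)) m))"

text \<open>\<open>\<delta>(P) = \<Sum>n\<in>\<int>. P\<^sup>n\<close>, again for the family of powers of the argument.\<close>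

definition fdelta :: "(int \<Rightarrow> complex fser) \<Rightarrow> complex fser" where
  "fdelta P = (\<lambda>m. Sum_any (\<lambda>n. P n m))"


section \<open>Vertex operator algebras\<close>

text \<open>
  The underlying space is the whole type \<open>'v\<close>. The field \<open>mode\<close> gives the products
  \<open>mode V u n v = u\<^sub>n v\<close>.
\<close>

record 'v voa_data =
  scl :: "complex \<Rightarrow> 'v \<Rightarrow> 'v"
  grade :: "int \<Rightarrow> 'v set"
  mode :: "'v \<Rightarrow> int \<Rightarrow> 'v \<Rightarrow> 'v"
  vac :: 'v
  conf :: 'v

definition Lop :: "'v voa_data \<Rightarrow> int \<Rightarrow> 'v \<Rightarrow> 'v" where
  "Lop V n = mode V (conf V) (n + 1)"

text \<open>The coefficient of \<open>x\<^sup>p\<close> (not \<open>x\<^sup>-\<^sup>p\<^sup>-\<^sup>1\<close>) in \<open>Y(u, x)\<close>.\<close>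

definition Ycoeff :: "'v voa_data \<Rightarrow> 'v \<Rightarrow> int \<Rightarrow> 'v \<Rightarrow> 'v" where
  "Ycoeff V u p = mode V u (- p - 1)"

definition vconst :: "'v::zero \<Rightarrow> 'v fser" where
  "vconst u = (\<lambda>m. if m = (\<lambda>_. 0) then u else 0)"

text \<open>
  Let \<open>F a n\<close> be the coefficient of \<open>x\<^sup>n\<close> in an operator series \<open>F(a, x)\<close>, for \<open>a\<close> in \<open>V\<close>.
  Then \<open>subst_op V F A Z\<close> is \<open>F(A, z)\<close>, where \<open>F\<close> is extended coefficientwise to the
  \<open>V\<close>-valued series \<open>A\<close>, and \<open>Z\<close> is the family of powers of \<open>z\<close>.
\<close>

definition subst_op ::
  "'v::ab_group_add voa_data \<Rightarrow> ('v \<Rightarrow> int \<Rightarrow> 'v \<Rightarrow> 'v) \<Rightarrow> 'v fser \<Rightarrow> (int \<Rightarrow> complex fser)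
     \<Rightarrow> ('v \<Rightarrow> 'v) fser" where
  "subst_op V F A Z = (\<lambda>m c. Sum_any (\<lambda>(k, n). scl V (Z n (m - k)) (F (A k) n c)))"

definition app_op :: "('v::ab_group_add \<Rightarrow> 'v) fser \<Rightarrow> 'v fser \<Rightarrow> 'v fser" where
  "app_op T B = (\<lambda>m. Sum_any (\<lambda>k. T (m - k) (B k)))"

definition comp_op ::
  "('v::ab_group_add \<Rightarrow> 'v) fser \<Rightarrow> ('v \<Rightarrow> 'v) fser \<Rightarrow> ('v \<Rightarrow> 'v) fser" (infixl \<open>\<odot>\<close> 70) where
  "S \<odot> T = (\<lambda>m c. Sum_any (\<lambda>k. S (m - k) (T k c)))"

definition scale_op ::
  "'v::ab_group_add voa_data \<Rightarrow> complex fser \<Rightarrow> ('v \<Rightarrow> 'v) fser \<Rightarrow> ('v \<Rightarrow> 'v) fser" where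
  "scale_op V f T = (\<lambda>m c. Sum_any (\<lambda>k. scl V (f k) (T (m - k) c)))"

definition Yop ::
  "'v::ab_group_add voa_data \<Rightarrow> 'v fser \<Rightarrow> (int \<Rightarrow> complex fser) \<Rightarrow> ('v \<Rightarrow> 'v) fser" where
  "Yop V = subst_op V (Ycoeff V)"

locale vertex_operator_algebra = vector_space "scl V"
  for V :: "'v::ab_group_add voa_data" +
  assumes grade_subspace: "subspace (grade V n)"
    and grade_direct_sum:
      "\<exists>!f. (\<forall>n. f n \<in> grade V n) \<and> finite {n. f n \<noteq> 0} \<and> Sum_any f = v"
    and grade_finite_dim: "\<exists>B. finite B \<and> span B = grade V n"
    and grade_bounded_below: "\<exists>N. \<forall>n<N. grade V n = {0}"
    and mode_linear_left: "Vector_Spaces.linear (scl V) (scl V) (\<lambda>u. mode V u n v)"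
    and mode_linear_right: "Vector_Spaces.linear (scl V) (scl V) (mode V u n)"
    and vac_grade: "vac V \<in> grade V 0"
    and conf_grade: "conf V \<in> grade V 2"
    and truncation: "\<exists>N. \<forall>n\<ge>N. mode V u n v = 0"
    and vacuum: "Ycoeff V (vac V) p v = (if p = 0 then v else 0)"
    and creation: "p < 0 \<Longrightarrow> Ycoeff V v p (vac V) = 0" "Ycoeff V v 0 (vac V) = v"
    and jacobi:
      "scale_op V
         (fmono X0 (- 1) \<star> fdelta (\<lambda>n. fdiff (fmono X1) (fmono X2) n \<star> fmono X0 (- n)))
         (Yop V (vconst u) (fmono X1) \<odot> Yop V (vconst v) (fmono X2))
       - scale_op V
         (fmono X0 (- 1) \<star>
            fdelta (\<lambda>n. fdiff (fmono X2) (fmono X1) n \<star> (\<lambda>m. (- 1) powi n * fmono X0 (- n) m)))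
         (Yop V (vconst v) (fmono X2) \<odot> Yop V (vconst u) (fmono X1))
       = scale_op V
         (fmono X2 (- 1) \<star> fdelta (\<lambda>n. fdiff (fmono X1) (fmono X0) n \<star> fmono X2 (- n)))
         (Yop V (app_op (Yop V (vconst u) (fmono X0)) (vconst v)) (fmono X2))"
    and virasoro:
      "\<exists>rank. \<forall>m n v. Lop V m (Lop V n v) - Lop V n (Lop V m v) =
         scl V (of_int (m - n)) (Lop V (m + n) v)
         + scl V (1 / 12 * of_int (m ^ 3 - m) * (if m + n = 0 then 1 else 0) * rank) v"
    and L0_grade: "v \<in> grade V n \<Longrightarrow> Lop V 0 v = scl V (of_int n) v"
    and derivative:
      "scl V (of_int (p + 1)) (Ycoeff V v (p + 1) w) = Ycoeff V (Lop V (- 1) v) p w"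


section \<open>The operators \<open>X(v, x)\<close> and \<open>Y[u, y]\<close>\<close>

definition homog :: "'v::ab_group_add voa_data \<Rightarrow> 'v \<Rightarrow> int \<Rightarrow> 'v" where
  "homog V v = (THE f. (\<forall>n. f n \<in> grade V n) \<and> finite {n. f n \<noteq> 0} \<and> Sum_any f = v)"

text \<open>The coefficient of \<open>x\<^sup>p\<close> in \<open>X(v, x) = \<Sum>n. x\<^sup>n Y(v\<^sub>(\<^sub>n\<^sub>), x)\<close>, where \<open>v\<^sub>(\<^sub>n\<^sub>)\<close> is
  the component of \<open>v\<close> of weight \<open>n\<close>.\<close>

definition Xcoeff :: "'v::ab_group_add voa_data \<Rightarrow> 'v \<Rightarrow> int \<Rightarrow> 'v \<Rightarrow> 'v" where
  "Xcoeff V v p c = Sum_any (\<lambda>n. Ycoeff V (homog V v n) (p - n) c)"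

definition Xop ::
  "'v::ab_group_add voa_data \<Rightarrow> 'v fser \<Rightarrow> (int \<Rightarrow> complex fser) \<Rightarrow> ('v \<Rightarrow> 'v) fser" where
  "Xop V = subst_op V (Xcoeff V)"

text \<open>The coefficient of \<open>y\<^sup>j\<close> in
  \<open>Y[u, y] = Y(e\<^sup>y\<^sup>L\<^sup>(\<^sup>0\<^sup>) u, e\<^sup>y - 1)
     = \<Sum>k\<ge>0. \<Sum>p. (y\<^sup>k / k!) (e\<^sup>y - 1)\<^sup>p Ycoeff (L(0)\<^sup>k u) p\<close>.\<close>

definition Bcoeff :: "'v::ab_group_add voa_data \<Rightarrow> 'v \<Rightarrow> int \<Rightarrow> 'v \<Rightarrow> 'v" where
  "Bcoeff V u j c = Sum_any (\<lambda>(k::nat, p).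
     scl V (fls_nth (fps_to_fls (fps_exp 1 - 1) powi p) (j - int k) / fact k)
       (Ycoeff V ((Lop V 0 ^^ k) u) p c))"

text \<open>\<open>brk V A Z B\<close> is \<open>Y[A, z]B\<close>, where \<open>Z\<close> is the family of powers of \<open>z\<close>.\<close>

definition brk ::
  "'v::ab_group_add voa_data \<Rightarrow> 'v fser \<Rightarrow> (int \<Rightarrow> complex fser) \<Rightarrow> 'v fser \<Rightarrow> 'v fser" where
  "brk V A Z B = app_op (subst_op V (Bcoeff V) A Z) B"


section \<open>Logarithmic series\<close>

text \<open>
  The series \<open>w\<^sub>2\<^sub>1, w\<^sub>1\<^sub>2, w\<^sub>0\<^sub>1\<close> are \<open>\<plusminus>log(1 - z)\<close> for a ratio \<open>z\<close> of two formal variables. Their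
  exponentials and the integer powers of these are formed in the field of Laurent series in \<open>z\<close>,
  and the ratio is then substituted with \<^const>\<open>fsubst\<close>. By the lemmas below this
  gives the binomial series of \<open>(1 - z)\<^sup>n\<close>.
\<close>

definition log1m :: "complex fps" where
  "log1m = Abs_fps (\<lambda>n. if n = 0 then 0 else - 1 / of_nat n)"

definition fexp :: "complex fps \<Rightarrow> complex fls" where
  "fexp w = fps_to_fls (fps_exp 1 oo w)"

lemma exp_log1m: "fps_exp 1 oo log1m = 1 - fps_X"
proof -
  have l: "log1m = fps_ln 1 oo (- fps_X)"
  proof (rule fps_ext)
    fix n
    have "fps_ln (1::complex) oo (- fps_X) = Abs_fps (\<lambda>n. (- 1) ^ n * fps_nth (fps_ln 1) n)"
      by (rule fps_compose_uminus')
    then show "fps_nth log1m n = fps_nth (fps_ln 1 oo (- fps_X)) n"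
      by (cases n) (simp_all add: log1m_def fps_ln_nth flip: power_add mult_2)
  qed
  have "(fps_exp 1 - 1) oo fps_ln (1::complex) = fps_X"
    by (simp add: fps_ln_fps_exp_inv fps_inv_right)
  then have e: "fps_exp 1 oo fps_ln (1::complex) = 1 + fps_X"
    by (simp add: fps_compose_sub_distrib algebra_simps)
  have "fps_exp 1 oo log1m = (fps_exp 1 oo fps_ln 1) oo (- fps_X)"
    unfolding l by (rule fps_compose_assoc) simp_all
  then show ?thesis
    by (simp add: e fps_compose_add_distrib)
qed

lemma fexp_log1m_power_int:
  "fexp log1m powi n = fps_to_fls (Abs_fps (\<lambda>k. (- 1) ^ k * (of_int n gchoose k)))"
proof -
  define b where "b = (\<lambda>a. fps_binomial (a::complex) oo (- fps_X))"
  have b1: "b 1 = 1 - fps_X"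
    by (simp add: b_def fps_binomial_1 fps_compose_add_distrib)
  have p: "b 1 ^ j = b (of_nat j)" for j
    by (simp add: b_def fps_compose_power fps_binomial_power)
  have m: "b a * b (- a) = 1" for a
    by (simp add: b_def flip: fps_compose_mult_distrib fps_binomial_add_mult)
  have "fps_to_fls (1 - fps_X) powi n = fps_to_fls (b (of_int n))"
  proof (cases "n \<ge> 0")
    case True
    then show ?thesis
      by (simp add: power_int_def p flip: b1 fps_to_fls_power)
  next
    case False
    have "fps_to_fls (b (of_int (- n))) * fps_to_fls (b (of_int n)) = 1"
      using m[of "of_int (- n)"] by (simp flip: fls_times_fps_to_fls)
    then have "inverse (fps_to_fls (b (of_int (- n)))) = fps_to_fls (b (of_int n))"
      by (rule inverse_unique)
    with False show ?thesis
      by (simp add: power_int_def p power_inverse flip: b1 fps_to_fls_power)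
  qed
  then show ?thesis
    by (simp add: fexp_def exp_log1m b_def fps_compose_uminus')
qed

text \<open>The integer powers of \<open>F(z)\<close>, where \<open>Z\<close> is the family of powers of \<open>z\<close>.\<close>

definition powers_of :: "complex fls \<Rightarrow> (int \<Rightarrow> complex fser) \<Rightarrow> int \<Rightarrow> complex fser" where
  "powers_of F Z n = fsubst (F powi n) Z"

text \<open>\<open>e\<^sup>w x\<close> for \<open>x = x\<^sub>1, w = w\<^sub>1\<close> and for \<open>x = x\<^sub>2, w = w\<^sub>2\<close>.\<close>

definition E1 :: "int \<Rightarrow> complex fser" where "E1 = emono X1 W1"
definition E2 :: "int \<Rightarrow> complex fser" where "E2 = emono X2 W2"

end

theory Submission
  imports Defs "HOL-Library.Product_Plus"
begin

text \<open>
  The coefficients of \<open>A\<^sub>1 = Y[u\<^sub>1, y\<^sub>1]v\<^sub>1\<close> and \<open>A\<^sub>2 = Y[u\<^sub>2, y\<^sub>2]v\<^sub>2\<close> are arbitrary vectors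
  \<open>a, b\<close> of \<open>V\<close> as far as the identity is concerned: the variables \<open>y\<^sub>1, y\<^sub>2\<close> occur nowhere else, so
  they merely index the coefficients. Both sides are bilinear in \<open>a\<close> and \<open>b\<close>, which may therefore be
  taken homogeneous, of weights \<open>h\<close> and \<open>g\<close>. The variables \<open>x\<^sub>1, w\<^sub>1\<close> and \<open>x\<^sub>2, w\<^sub>2\<close> occur only in the
  combinations \<open>z\<^sub>1 = e\<^sup>w\<^sup>1 x\<^sub>1\<close> and \<open>z\<^sub>2 = e\<^sup>w\<^sup>2 x\<^sub>2\<close>. The claim is then the Jacobi
  identity for \<open>a, b\<close> in the variables \<open>x\<^sub>0, z\<^sub>1, z\<^sub>2\<close>, multiplied by \<open>z\<^sub>1\<^sup>h z\<^sub>2\<^sup>g\<close>.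

  On the left this is visible at once: \<open>e\<^sup>w\<^sup>2\<^sup>1 z\<^sub>1 = z\<^sub>1 - z\<^sub>2\<close> and \<open>- e\<^sup>w\<^sup>1\<^sup>2 z\<^sub>2 = - (z\<^sub>2 - z\<^sub>1)\<close>,
  and \<open>X(a, z\<^sub>1) = z\<^sub>1\<^sup>h Y(a, z\<^sub>1)\<close>. On the right, \<open>e\<^sup>w\<^sup>0\<^sup>1 = (1 - x\<^sub>0/z\<^sub>1)\<^sup>-\<^sup>1\<close>, so
  that \<open>e\<^sup>w\<^sup>0\<^sup>1 - 1 = x\<^sub>0 / (z\<^sub>1 - x\<^sub>0)\<close> and the coefficient of \<open>x\<^sub>0\<^sup>p\<close> in \<open>Y(a, x\<^sub>0)b\<close>, a vector of
  weight \<open>h + g + p\<close>, enters \<open>X(Y[a, w\<^sub>0\<^sub>1]b, z\<^sub>2)\<close> with the factor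
  \<open>(1 - x\<^sub>0/z\<^sub>1)\<^sup>-\<^sup>h (x\<^sub>0 / (z\<^sub>1 - x\<^sub>0))\<^sup>p z\<^sub>2\<^sup>h\<^sup>+\<^sup>g\<^sup>+\<^sup>p\<close>. Under the delta function \<open>z\<^sub>2\<close> may be replaced
  by \<open>z\<^sub>1 - x\<^sub>0\<close> in this factor, which leaves \<open>z\<^sub>1\<^sup>h x\<^sub>0\<^sup>p z\<^sub>2\<^sup>g\<close>. For coefficients, this replacement
  is the Vandermonde convolution (\<open>bracket_sum_homogeneous\<close>).

  Two ingredients have to be supplied. The weight of the coefficients of \<open>Y(a, x\<^sub>0)b\<close> is
  not an axiom; it follows from the commutator of \<open>L(0)\<close> with vertex operators (\<open>Lop_0_bracket\<close>),
  itself a coefficient of the Jacobi identity. And the reduction to coefficients involves sums over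
  infinite index sets, whose finiteness must be checked. To do this only once, series in \<open>x\<^sub>0, z\<^sub>1, z\<^sub>2\<close>
  are treated with \<open>z\<^sub>i = e\<^sup>t\<^sup>w\<^sup>i x\<^sub>i\<close> for a number \<open>t\<close>: for \<open>t = 0\<close> they are the series
  of the Jacobi axiom, for \<open>t = 1\<close> those of the theorem (\<open>scale_op_delta01\<close>, \<open>scale_op_delta02\<close>,
  \<open>scale_op_delta12\<close>).
\<close>

section \<open>Sums with finite support\<close>

lemma Sum_any_reindex_inj:
  fixes f :: "'b \<Rightarrow> 'c::comm_monoid_add"
  assumes "inj h" and "\<And>y. y \<notin> range h \<Longrightarrow> f y = 0"
  shows "Sum_any f = Sum_any (\<lambda>x. f (h x))"
proof -
  have "{y. f y \<noteq> 0} = h ` {x. f (h x) \<noteq> 0}"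
    using assms(2) by (auto simp: image_def) metis
  moreover have "inj_on h {x. f (h x) \<noteq> 0}"
    using assms(1) by (rule inj_on_subset) simp
  ultimately show ?thesis
    unfolding Sum_any.expand_set by (simp add: sum.reindex)
qed

lemma Sum_any_single:
  fixes f :: "'b \<Rightarrow> 'c::comm_monoid_add"
  assumes "\<And>k. k \<noteq> k0 \<Longrightarrow> f k = 0"
  shows "Sum_any f = f k0"
  using Sum_any.expand_superset[of "{k0}" f] assms by auto

lemma Sum_any_fst_single:
  fixes f :: "'b \<times> 'c \<Rightarrow> 'd::comm_monoid_add"
  assumes "\<And>k n. k \<noteq> k0 \<Longrightarrow> f (k, n) = 0"
  shows "Sum_any f = Sum_any (\<lambda>n. f (k0, n))"
  by (rule Sum_any_reindex_inj) (use assms in \<open>auto simp: inj_def\<close>)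

text \<open>
  Multiplication by \<open>c \<noteq> 0\<close> keeps the support, so both sides have the default value 0 together when
  the support is infinite.
\<close>

lemma (in vector_space) Sum_any_scale:
  "Sum_any (\<lambda>i. scale c (f i)) = scale c (Sum_any f)"
proof (cases "c = 0")
  case False
  then show ?thesis
    by (simp add: Sum_any.expand_set scale_sum_right)
qed simp

lemma vector_space_times: "vector_space ((*) :: complex \<Rightarrow> complex \<Rightarrow> complex)"
  by unfold_locales (simp_all add: algebra_simps)

lemma Sum_any_mult_left: "Sum_any (\<lambda>i. c * f i) = c * Sum_any f" for c :: complex
  by (rule vector_space.Sum_any_scale[OF vector_space_times])

section \<open>Series in \<open>x\<^sub>0\<close>, \<open>e\<^sup>t\<^sup>w\<^sup>1 x\<^sub>1\<close> and \<open>e\<^sup>t\<^sup>w\<^sup>2 x\<^sub>2\<close>\<close>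

text \<open>
  The coefficient of \<open>w\<^sup>a\<close> in \<open>(e\<^sup>t\<^sup>w)\<^sup>n\<close>; at \<open>t = 0\<close>, where \<open>0\<^sup>0 = 1\<close>, it is that of the constant
  series 1.
\<close>

definition exp_coeff :: "complex \<Rightarrow> int \<Rightarrow> int \<Rightarrow> complex" where
  "exp_coeff t n a = (if a \<ge> 0 then (t * of_int n) ^ nat a / fact (nat a) else 0)"

lemma exp_coeff_zero: "exp_coeff t 0 a = (if a = 0 then 1 else 0)"
  by (auto simp: exp_coeff_def power_0_left)

lemma exp_coeff_zero_left: "exp_coeff 0 n a = (if a = 0 then 1 else 0)"
  by (auto simp: exp_coeff_def power_0_left)

lemma exp_coeff_at_0 [simp]: "exp_coeff t n 0 = 1"
  by (simp add: exp_coeff_def)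

text \<open>
  The law \<open>(e\<^sup>t\<^sup>w)\<^sup>p (e\<^sup>t\<^sup>w)\<^sup>q = (e\<^sup>t\<^sup>w)\<^sup>p\<^sup>+\<^sup>q\<close>, which is what makes the substitution of \<open>e\<^sup>t\<^sup>w x\<close> for \<open>x\<close>
  multiplicative.
\<close>

lemma exp_coeff_add:
  "(\<Sum>i\<in>{0..a}. exp_coeff t p i * exp_coeff t q (a - i)) = exp_coeff t (p + q) a"
proof (cases "a \<ge> 0")
  case True
  define n where "n = nat a"
  have a: "a = int n" using True by (simp add: n_def)
  have "(\<Sum>i\<in>{0..a}. exp_coeff t p i * exp_coeff t q (a - i))
      = (\<Sum>i\<in>{0..n}. exp_coeff t p (int i) * exp_coeff t q (a - int i))"
    by (rule sum.reindex_bij_witness[of _ int nat]) (auto simp: a)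
  also have "\<dots> = (\<Sum>i=0..n. fps_nth (fps_exp (t * of_int p)) i * fps_nth (fps_exp (t * of_int q)) (n - i))"
    by (rule sum.cong) (auto simp: exp_coeff_def a nat_diff_distrib)
  also have "\<dots> = fps_nth (fps_exp (t * of_int (p + q))) n"
    by (simp add: fps_mult_nth distrib_left fps_exp_add_mult)
  finally show ?thesis by (simp add: exp_coeff_def a)
qed (simp add: exp_coeff_def)

text \<open>
  The factor by which the monomial \<open>m\<close> is weighted when \<open>e\<^sup>t\<^sup>w\<^sup>1 x\<^sub>1\<close> and \<open>e\<^sup>t\<^sup>w\<^sup>2 x\<^sub>2\<close> are substituted
  for \<open>x\<^sub>1\<close> and \<open>x\<^sub>2\<close> in a series free of \<open>w\<^sub>1\<close> and \<open>w\<^sub>2\<close>.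
\<close>

definition wcoeff :: "complex \<Rightarrow> mono \<Rightarrow> complex" where
  "wcoeff t m = exp_coeff t (m X1) (m W1) * exp_coeff t (m X2) (m W2)"

definition exps :: "mono \<Rightarrow> int \<times> int \<times> int" where
  "exps m = (m X0, m X1, m X2)"

text \<open>
  The scalar series \<open>\<Sum> \<phi>(p, q, r) x\<^sub>0\<^sup>p (e\<^sup>t\<^sup>w\<^sup>1 x\<^sub>1)\<^sup>q (e\<^sup>t\<^sup>w\<^sup>2 x\<^sub>2)\<^sup>r\<close>.
\<close>

definition eseries :: "complex \<Rightarrow> (int \<times> int \<times> int \<Rightarrow> complex) \<Rightarrow> complex fser" where
  "eseries t \<phi> m = (if m Y1 = 0 \<and> m Y2 = 0 then wcoeff t m * \<phi> (exps m) else 0)"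

definition emonom :: "complex \<Rightarrow> int \<times> int \<times> int \<Rightarrow> complex fser" where
  "emonom t e = eseries t (\<lambda>e'. if e' = e then 1 else 0)"

lemma all_fvar: "(\<forall>z. P z) \<longleftrightarrow> P X0 \<and> P X1 \<and> P X2 \<and> P Y1 \<and> P Y2 \<and> P W1 \<and> P W2"
  by (metis fvar.exhaust)

lemma mono_eq_iff: "m = m' \<longleftrightarrow> m X0 = m' X0 \<and> m X1 = m' X1 \<and> m X2 = m' X2 \<and> m Y1 = m' Y1
    \<and> m Y2 = m' Y2 \<and> m W1 = m' W1 \<and> m W2 = m' W2" for m m' :: mono
  by (simp add: fun_eq_iff all_fvar)

lemma fmono_X0: "fmono X0 n = emonom t (n, 0, 0)"
  by (rule ext) (auto simp: fmono_def emonom_def eseries_def exps_def wcoeff_def mono_eq_iff exp_coeff_zero)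

lemma fmono_X1: "fmono X1 n = emonom 0 (0, n, 0)"
  and fmono_X2: "fmono X2 n = emonom 0 (0, 0, n)"
  by (rule ext; auto simp: fmono_def emonom_def eseries_def exps_def wcoeff_def mono_eq_iff
      exp_coeff_zero_left exp_coeff_zero)+

text \<open>
  The existential quantifier over the exponent of \<open>w\<close> is absorbed by \<open>exp_coeff\<close>, which vanishes at
  negative exponents.
\<close>

lemma emono_altdef:
  assumes "x \<noteq> w"
  shows "emono x w n = (\<lambda>m. if m x = n \<and> (\<forall>z. z \<noteq> x \<and> z \<noteq> w \<longrightarrow> m z = 0)
                              then exp_coeff 1 n (m w) else 0)"
proof
  fix m :: mono
  have *: "(\<exists>a::nat. m = (\<lambda>_. 0)(x := n, w := int a)) \<longleftrightarrow>
        0 \<le> m w \<and> m x = n \<and> (\<forall>z. z \<noteq> x \<and> z \<noteq> w \<longrightarrow> m z = 0)"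
    using assms by (auto simp: fun_eq_iff intro!: exI[of _ "nat (m w)"])
  show "emono x w n m = (if m x = n \<and> (\<forall>z. z \<noteq> x \<and> z \<noteq> w \<longrightarrow> m z = 0)
                              then exp_coeff 1 n (m w) else 0)"
    unfolding emono_def * by (auto simp: exp_coeff_def)
qed

lemma E1_emonom: "E1 n = emonom 1 (0, n, 0)"
  and E2_emonom: "E2 n = emonom 1 (0, 0, n)"
  by (rule ext; auto simp: E1_def E2_def emono_altdef emonom_def eseries_def exps_def wcoeff_def
      all_fvar exp_coeff_zero)+

definition monomial :: "int \<times> int \<times> int \<Rightarrow> int \<Rightarrow> int \<Rightarrow> mono" where
  "monomial e a b = (\<lambda>z. case z of X0 \<Rightarrow> fst e | X1 \<Rightarrow> fst (snd e) | X2 \<Rightarrow> snd (snd e)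
     | Y1 \<Rightarrow> 0 | Y2 \<Rightarrow> 0 | W1 \<Rightarrow> a | W2 \<Rightarrow> b)"

lemma monomial_simps [simp]:
  "monomial e a b X0 = fst e" "monomial e a b X1 = fst (snd e)" "monomial e a b X2 = snd (snd e)"
  "monomial e a b Y1 = 0" "monomial e a b Y2 = 0" "monomial e a b W1 = a" "monomial e a b W2 = b"
  "exps (monomial e a b) = e"
  by (simp_all add: monomial_def exps_def)

lemma exps_diff: "exps (m - k) = exps m - exps k"
  by (simp add: exps_def)

text \<open>
  The one place where the variables \<open>w\<^sub>1, w\<^sub>2\<close> are multiplied out. The exponents \<open>a, b\<close> of \<open>w\<^sub>1, w\<^sub>2\<close>
  in the first factor run through finite intervals and their contributions add up to
  \<open>wcoeff t m\<close> by \<open>exp_coeff_add\<close>; a convolution over the exponents of \<open>x\<^sub>0, x\<^sub>1, x\<^sub>2\<close> remains. The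
  scalar multiplication is a parameter, so that the lemma covers products of scalar series as well as
  scalar series times operator series.
\<close>

lemma eseries_convolution:
  fixes s :: "complex \<Rightarrow> 'b::ab_group_add \<Rightarrow> 'b"
  assumes "vector_space s"
    and fin: "finite {e. \<phi> e \<noteq> 0 \<and> \<tau> (exps m - e) (m Y1) (m Y2) \<noteq> 0}"
  shows "Sum_any (\<lambda>k. s (eseries t \<phi> k)
            (s (wcoeff t (m - k)) (\<tau> (exps (m - k)) ((m - k) Y1) ((m - k) Y2))))
         = s (wcoeff t m) (Sum_any (\<lambda>e. s (\<phi> e) (\<tau> (exps m - e) (m Y1) (m Y2))))"
    (is "Sum_any ?f = _")
proof -
  interpret vector_space s by fact
  define S where "S = {e. \<phi> e \<noteq> 0 \<and> \<tau> (exps m - e) (m Y1) (m Y2) \<noteq> 0}"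
  define T where "T = S \<times> {0..m W1} \<times> {0..m W2}"
  define h where "h = (\<lambda>(e, a, b). monomial e a b)"
  have inj: "inj_on h T"
    by (auto simp: inj_on_def h_def mono_eq_iff prod_eq_iff)
  have sub: "{k. ?f k \<noteq> 0} \<subseteq> h ` T"
  proof
    fix k assume "k \<in> {k. ?f k \<noteq> 0}"
    then have nz: "eseries t \<phi> k \<noteq> 0" "wcoeff t (m - k) \<noteq> 0"
      "\<tau> (exps (m - k)) ((m - k) Y1) ((m - k) Y2) \<noteq> 0"
      by auto
    from nz(1) have k: "k Y1 = 0" "k Y2 = 0" "\<phi> (exps k) \<noteq> 0" "wcoeff t k \<noteq> 0"
      by (auto simp: eseries_def split: if_splits)
    from k(4) have "k W1 \<ge> 0" "k W2 \<ge> 0"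
      by (auto simp: wcoeff_def exp_coeff_def split: if_splits)
    moreover from nz(2) have "k W1 \<le> m W1" "k W2 \<le> m W2"
      by (auto simp: wcoeff_def exp_coeff_def split: if_splits)
    moreover have "exps k \<in> S"
      using nz(3) k by (simp add: S_def exps_diff)
    moreover have "k = h (exps k, k W1, k W2)"
      by (simp add: h_def mono_eq_iff k) (simp add: exps_def)
    ultimately show "k \<in> h ` T"
      by (auto simp: T_def)
  qed
  have "Sum_any ?f = sum ?f (h ` T)"
    by (rule Sum_any.expand_superset[OF _ sub]) (use fin in \<open>simp add: T_def S_def\<close>)
  also have "\<dots> = (\<Sum>(e, a, b)\<in>T. s ((exp_coeff t (fst (snd e)) a * exp_coeff t (m X1 - fst (snd e)) (m W1 - a))
       * (exp_coeff t (snd (snd e)) b * exp_coeff t (m X2 - snd (snd e)) (m W2 - b)))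
       (s (\<phi> e) (\<tau> (exps m - e) (m Y1) (m Y2))))"
    unfolding sum.reindex[OF inj] o_def
    by (rule sum.cong) (auto simp: h_def eseries_def exps_diff wcoeff_def mult_ac)
  also have "\<dots> = (\<Sum>e\<in>S. \<Sum>(a, b)\<in>{0..m W1} \<times> {0..m W2}. s ((exp_coeff t (fst (snd e)) a * exp_coeff t (m X1 - fst (snd e)) (m W1 - a))
       * (exp_coeff t (snd (snd e)) b * exp_coeff t (m X2 - snd (snd e)) (m W2 - b)))
       (s (\<phi> e) (\<tau> (exps m - e) (m Y1) (m Y2))))"
    unfolding T_def by (rule sum.cartesian_product[symmetric])
  also have "\<dots> = (\<Sum>e\<in>S. s (wcoeff t m) (s (\<phi> e) (\<tau> (exps m - e) (m Y1) (m Y2))))"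
  proof (rule sum.cong[OF refl])
    fix e :: "int \<times> int \<times> int"
    let ?g = "\<lambda>a. exp_coeff t (fst (snd e)) a * exp_coeff t (m X1 - fst (snd e)) (m W1 - a)"
    let ?h = "\<lambda>b. exp_coeff t (snd (snd e)) b * exp_coeff t (m X2 - snd (snd e)) (m W2 - b)"
    have "wcoeff t m = (\<Sum>a\<in>{0..m W1}. ?g a) * (\<Sum>b\<in>{0..m W2}. ?h b)"
      unfolding exp_coeff_add by (simp add: wcoeff_def)
    also have "\<dots> = (\<Sum>(a, b)\<in>{0..m W1} \<times> {0..m W2}. ?g a * ?h b)"
      by (simp add: sum_product sum.cartesian_product)
    finally show "(\<Sum>(a, b)\<in>{0..m W1} \<times> {0..m W2}. s (?g a * ?h b)
       (s (\<phi> e) (\<tau> (exps m - e) (m Y1) (m Y2)))) =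
       s (wcoeff t m) (s (\<phi> e) (\<tau> (exps m - e) (m Y1) (m Y2)))"
      by (simp only: scale_sum_left case_prod_unfold)
  qed
  also have "\<dots> = s (wcoeff t m) (\<Sum>e\<in>S. s (\<phi> e) (\<tau> (exps m - e) (m Y1) (m Y2)))"
    by (rule scale_sum_right[symmetric])
  also have "(\<Sum>e\<in>S. s (\<phi> e) (\<tau> (exps m - e) (m Y1) (m Y2))) =
      Sum_any (\<lambda>e. s (\<phi> e) (\<tau> (exps m - e) (m Y1) (m Y2)))"
    by (rule Sum_any.expand_superset[symmetric]) (use fin in \<open>auto simp: S_def\<close>)
  finally show ?thesis .
qed

text \<open>
  The next lemmas form a calculus in which all scalar series in the Jacobi axiom and in the theorem
  are brought into the form \<open>eseries t \<phi>\<close>. Every product that occurs there has a monomial as one of its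
  factors, so that a single term contributes to each of its coefficients.
\<close>

lemma fmul_eseries:
  assumes "\<And>e'. finite {e. \<phi> e \<noteq> 0 \<and> \<psi> (e' - e) \<noteq> 0}"
  shows "eseries t \<phi> \<star> eseries t \<psi> = eseries t (\<lambda>e'. Sum_any (\<lambda>e. \<phi> e * \<psi> (e' - e)))"
proof
  fix m
  have fin: "finite {e. \<phi> e \<noteq> 0 \<and> (if m Y1 = 0 \<and> m Y2 = 0 then \<psi> (exps m - e) else 0) \<noteq> 0}"
    by (rule finite_subset[OF _ assms[of "exps m"]]) auto
  have "(eseries t \<phi> \<star> eseries t \<psi>) m = Sum_any (\<lambda>k. eseries t \<phi> k * (wcoeff t (m - k) *
     (if (m - k) Y1 = 0 \<and> (m - k) Y2 = 0 then \<psi> (exps (m - k)) else 0)))"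
    unfolding fmul_def by (rule Sum_any.cong) (simp add: eseries_def)
  also have "\<dots> = wcoeff t m * Sum_any (\<lambda>e. \<phi> e *
     (if m Y1 = 0 \<and> m Y2 = 0 then \<psi> (exps m - e) else 0))"
    using eseries_convolution[where \<tau> = "\<lambda>e y1 y2. if y1 = 0 \<and> y2 = 0 then \<psi> e else 0",
        OF vector_space_times fin] .
  finally show "(eseries t \<phi> \<star> eseries t \<psi>) m = eseries t (\<lambda>e'. Sum_any (\<lambda>e. \<phi> e * \<psi> (e' - e))) m"
    by (cases "m Y1 = 0 \<and> m Y2 = 0") (auto simp: eseries_def)
qed

lemma fmul_emonom_right: "eseries t \<phi> \<star> emonom t e = eseries t (\<lambda>e'. \<phi> (e' - e))"
proof -
  have *: "e' - k = e \<longleftrightarrow> k = e' - e" for e' k :: "int \<times> int \<times> int"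
    by (auto simp: algebra_simps)
  have "Sum_any (\<lambda>k. \<phi> k * (if e' - k = e then 1 else 0)) = \<phi> (e' - e)" for e'
    by (subst Sum_any_single[of "e' - e"]) (auto simp: *)
  then show ?thesis
    unfolding emonom_def by (subst fmul_eseries) (simp_all add: *)
qed

lemma fmul_emonom_left: "emonom t e \<star> eseries t \<phi> = eseries t (\<lambda>e'. \<phi> (e' - e))"
proof -
  have "Sum_any (\<lambda>k. (if k = e then 1 else 0) * \<phi> (e' - k)) = \<phi> (e' - e)" for e'
    by (subst Sum_any_single[of "e"]) auto
  then show ?thesis
    unfolding emonom_def by (subst fmul_eseries) simp_all
qed

lemma fmul_emonom: "emonom t e \<star> emonom t e' = emonom t (e + e')"
  unfolding emonom_def[of t "e"] fmul_emonom_right unfolding emonom_def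
  by (simp add: algebra_simps)

lemma Sum_any_eseries: "(\<lambda>m. Sum_any (\<lambda>i. eseries t (\<phi> i) m)) = eseries t (\<lambda>e. Sum_any (\<lambda>i. \<phi> i e))"
proof
  fix m show "Sum_any (\<lambda>i. eseries t (\<phi> i) m) = eseries t (\<lambda>e. Sum_any (\<lambda>i. \<phi> i e)) m"
    by (cases "m Y1 = 0 \<and> m Y2 = 0") (auto simp: eseries_def Sum_any_mult_left)
qed

lemma scale_eseries: "c * eseries t \<phi> m = eseries t (\<lambda>e. c * \<phi> e) m"
  by (simp add: eseries_def)

lemma fdelta_eseries: "fdelta (\<lambda>n. eseries t (\<phi> n)) = eseries t (\<lambda>e. Sum_any (\<lambda>n. \<phi> n e))"
  unfolding fdelta_def by (rule Sum_any_eseries)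

section \<open>The delta functions\<close>

text \<open>
  The coefficient of \<open>z\<^sup>j\<close> in \<open>(1 - z)\<^sup>n\<close>, for \<open>j\<close> in \<open>\<int>\<close>.
\<close>

definition pow1m_coeff :: "int \<Rightarrow> int \<Rightarrow> complex" where
  "pow1m_coeff n j = (if j \<ge> 0 then (- 1) ^ nat j * (of_int n gchoose nat j) else 0)"

lemma fls_nth_exp_log1m_powi: "fls_nth (fexp log1m powi n) j = pow1m_coeff n j"
  by (auto simp: fexp_log1m_power_int pow1m_coeff_def)

lemma Sum_any_if_nat:
  "Sum_any (\<lambda>k::nat. f k * (if Q \<and> r = int k then 1 else (0::complex))) = (if Q \<and> r \<ge> 0 then f (nat r) else 0)"
  by (subst Sum_any_single[of "nat r"]) auto

lemma Sum_any_if_int: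
  "Sum_any (\<lambda>n::int. f n * (if Q \<and> r = n then 1 else (0::complex))) = (if Q then f r else 0)"
  by (subst Sum_any_single[of r]) auto

lemma scale_emonom: "c * emonom t e m = eseries t (\<lambda>e'. c * (if e' = e then 1 else 0)) m"
  by (simp add: emonom_def scale_eseries)

lemma fdiff_emonom:
  assumes "\<And>k::nat. A (n - int k) \<star> B (int k) = emonom t (g k)"
  shows "fdiff A B n = eseries t (\<lambda>e. Sum_any (\<lambda>k::nat. ((- 1) ^ k * (of_int n gchoose k)) * (if e = g k then 1 else 0)))"
  unfolding fdiff_def assms scale_emonom Sum_any_eseries ..

lemma fsubst_emonom:
  assumes "\<And>n. Z n = emonom t (g n)"
  shows "fsubst F Z = eseries t (\<lambda>e. Sum_any (\<lambda>n. fls_nth F n * (if e = g n then 1 else 0)))"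
  unfolding fsubst_def assms scale_emonom Sum_any_eseries ..

lemma fmul_emonom_fdelta:
  assumes "\<And>n. P n = eseries t (\<phi> n)"
  shows "emonom t e \<star> fdelta P = eseries t (\<lambda>e'. Sum_any (\<lambda>n. \<phi> n (e' - e)))"
proof -
  have "P = (\<lambda>n. eseries t (\<phi> n))" using assms by (rule ext)
  then show ?thesis by (simp add: fdelta_eseries fmul_emonom_left)
qed

lemma eseries_cong: "(\<And>p q r. \<phi> (p, q, r) = \<psi> (p, q, r)) \<Longrightarrow> eseries t \<phi> = eseries t \<psi>"
  by (rule arg_cong[where f = "eseries t"]) (auto simp: fun_eq_iff)

text \<open>
  The coefficients of \<open>x\<^sub>0\<^sup>-\<^sup>1 \<delta>((x\<^sub>1 - x\<^sub>2)/x\<^sub>0)\<close>, \<open>x\<^sub>0\<^sup>-\<^sup>1 \<delta>((x\<^sub>2 - x\<^sub>1)/(-x\<^sub>0))\<close> and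
  \<open>x\<^sub>2\<^sup>-\<^sup>1 \<delta>((x\<^sub>1 - x\<^sub>0)/x\<^sub>2)\<close>. All three are homogeneous of degree \<open>-1\<close>, and the exponent
  \<open>n\<close> of the summand \<open>((x\<^sub>1 - x\<^sub>2)/x\<^sub>0)\<^sup>n\<close> can be read off from the exponent of the denominator.
\<close>

definition delta01_coeff :: "int \<times> int \<times> int \<Rightarrow> complex" where
  "delta01_coeff = (\<lambda>(p, q, r). if p + q + r = - 1 then pow1m_coeff (- p - 1) r else 0)"

definition delta02_coeff :: "int \<times> int \<times> int \<Rightarrow> complex" where
  "delta02_coeff = (\<lambda>(p, q, r). if p + q + r = - 1 then (- 1) powi (- p - 1) * pow1m_coeff (- p - 1) q else 0)"

definition delta12_coeff :: "int \<times> int \<times> int \<Rightarrow> complex" where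
  "delta12_coeff = (\<lambda>(p, q, r). if p + q + r = - 1 then pow1m_coeff (- r - 1) p else 0)"

lemma fdiff_X1_X2: "fdiff (fmono X1) (fmono X2) n =
    eseries 0 (\<lambda>(p, q, r). if p = 0 \<and> q + r = n then pow1m_coeff n r else 0)"
proof -
  have eq: "(p, q, r) = (0, n - int k, int k) \<longleftrightarrow> (p = 0 \<and> q + r = n) \<and> r = int k" for p q r k
    by auto
  show ?thesis
    by (subst fdiff_emonom[where t = 0 and g = "\<lambda>k. (0, n - int k, int k)"])
       (simp add: fmono_X1 fmono_X2 fmul_emonom,
        rule eseries_cong, simp only: eq Sum_any_if_nat Sum_any_if_int, simp add: pow1m_coeff_def)
qed

lemma fdiff_X2_X1: "fdiff (fmono X2) (fmono X1) n =
    eseries 0 (\<lambda>(p, q, r). if p = 0 \<and> q + r = n then pow1m_coeff n q else 0)"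
proof -
  have eq: "(p, q, r) = (0, int k, n - int k) \<longleftrightarrow> (p = 0 \<and> q + r = n) \<and> q = int k" for p q r k
    by auto
  show ?thesis
    by (subst fdiff_emonom[where t = 0 and g = "\<lambda>k. (0, int k, n - int k)"])
       (simp add: fmono_X1 fmono_X2 fmul_emonom,
        rule eseries_cong, simp only: eq Sum_any_if_nat Sum_any_if_int, simp add: pow1m_coeff_def)
qed

lemma fdiff_X1_X0: "fdiff (fmono X1) (fmono X0) n =
    eseries 0 (\<lambda>(p, q, r). if r = 0 \<and> p + q = n then pow1m_coeff n p else 0)"
proof -
  have eq: "(p, q, r) = (int k, n - int k, 0) \<longleftrightarrow> (r = 0 \<and> p + q = n) \<and> p = int k" for p q r k
    by auto
  show ?thesis
    by (subst fdiff_emonom[where t = 0 and g = "\<lambda>k. (int k, n - int k, 0)"])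
       (simp add: fmono_X1 fmono_X0[of _ 0] fmul_emonom,
        rule eseries_cong, simp only: eq Sum_any_if_nat Sum_any_if_int, simp add: pow1m_coeff_def)
qed

lemma fsubst_21: "fsubst F (ratio E2 E1) = eseries 1 (\<lambda>(p, q, r). if p = 0 \<and> q + r = 0 then fls_nth F r else 0)"
proof -
  have eq: "(p, q, r) = (0, - n, n) \<longleftrightarrow> (p = 0 \<and> q + r = 0) \<and> r = n" for p q r n :: int
    by auto
  show ?thesis
    by (subst fsubst_emonom[where t = 1 and g = "\<lambda>n. (0, -n, n)"])
       (simp add: ratio_def E1_emonom E2_emonom fmul_emonom,
        rule eseries_cong, simp only: eq Sum_any_if_nat Sum_any_if_int, simp add: pow1m_coeff_def)
qed

lemma fsubst_12: "fsubst F (ratio E1 E2) = eseries 1 (\<lambda>(p, q, r). if p = 0 \<and> q + r = 0 then fls_nth F q else 0)"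
proof -
  have eq: "(p, q, r) = (0, n, - n) \<longleftrightarrow> (p = 0 \<and> q + r = 0) \<and> q = n" for p q r n :: int
    by auto
  show ?thesis
    by (subst fsubst_emonom[where t = 1 and g = "\<lambda>n. (0, n, -n)"])
       (simp add: ratio_def E1_emonom E2_emonom fmul_emonom,
        rule eseries_cong, simp only: eq Sum_any_if_nat Sum_any_if_int, simp add: pow1m_coeff_def)
qed

lemma fsubst_01: "fsubst F (ratio (fmono X0) E1) = eseries 1 (\<lambda>(p, q, r). if r = 0 \<and> p + q = 0 then fls_nth F p else 0)"
proof -
  have eq: "(p, q, r) = (n, - n, 0) \<longleftrightarrow> (r = 0 \<and> p + q = 0) \<and> p = n" for p q r n :: int
    by auto
  show ?thesis
    by (subst fsubst_emonom[where t = 1 and g = "\<lambda>n. (n, -n, 0)"])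
       (simp add: ratio_def E1_emonom fmono_X0[of _ 1] fmul_emonom,
        rule eseries_cong, simp only: eq Sum_any_if_nat Sum_any_if_int, simp add: pow1m_coeff_def)
qed

text \<open>
  Each delta function of the Jacobi axiom has the same coefficients as its counterpart in the theorem,
  because \<open>e\<^sup>w\<^sup>2\<^sup>1\<close>, \<open>e\<^sup>w\<^sup>1\<^sup>2\<close> and \<open>e\<^sup>-\<^sup>w\<^sup>0\<^sup>1\<close> are the series \<open>1 - z\<close> for the respective ratio \<open>z\<close>.
\<close>

lemma delta01_fmono:
  "fmono X0 (- 1) \<star> fdelta (\<lambda>n. fdiff (fmono X1) (fmono X2) n \<star> fmono X0 (- n)) = eseries 0 delta01_coeff"
  unfolding fmono_X0[of _ 0]
  apply (subst fmul_emonom_fdelta)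
   apply (simp only: fdiff_X1_X2 fmul_emonom_right)
  apply (rule eseries_cong)
  subgoal for p q r
    by (subst Sum_any_single[of "- p - 1"]) (auto simp: delta01_coeff_def)
  done

lemma delta01_emono:
  "fmono X0 (- 1) \<star> fdelta (\<lambda>n. powers_of (fexp log1m) (ratio E2 E1) n \<star> ratio E1 (fmono X0) n)
     = eseries 1 delta01_coeff"
  unfolding fmono_X0[of "-1" 1] powers_of_def fsubst_21
  apply (subst fmul_emonom_fdelta)
   apply (simp only: ratio_def fmono_X0[of _ 1] E1_emonom fmul_emonom fmul_emonom_right)
  apply (rule eseries_cong)
  subgoal for p q r
    by (subst Sum_any_single[of "- p - 1"]) (auto simp: delta01_coeff_def fls_nth_exp_log1m_powi)
  done

lemma delta02_fmono:
  "fmono X0 (- 1) \<star> fdelta (\<lambda>n. fdiff (fmono X2) (fmono X1) n \<star> (\<lambda>m. (- 1) powi n * fmono X0 (- n) m))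
     = eseries 0 delta02_coeff"
proof -
  have *: "eseries 0 \<phi> \<star> (\<lambda>m. (- 1) powi n * fmono X0 (- n) m) = eseries 0 (\<lambda>e. (- 1) powi n * \<phi> (e - (-n,0,0)))"
    for \<phi> n
  proof
    fix m
    have "(eseries 0 \<phi> \<star> (\<lambda>m. (- 1) powi n * fmono X0 (- n) m)) m = (- 1) powi n * (eseries 0 \<phi> \<star> fmono X0 (- n)) m"
      unfolding fmul_def by (simp add: mult.left_commute Sum_any_mult_left)
    then show "(eseries 0 \<phi> \<star> (\<lambda>m. (- 1) powi n * fmono X0 (- n) m)) m = eseries 0 (\<lambda>e. (- 1) powi n * \<phi> (e - (-n,0,0))) m"
      by (simp add: fmono_X0[of _ 0] fmul_emonom_right scale_eseries)
  qed
  show ?thesis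
    unfolding fmono_X0[of "-1" 0]
    apply (subst fmul_emonom_fdelta)
     apply (simp only: fdiff_X2_X1 *)
    apply (rule eseries_cong)
    subgoal for p q r
      by (subst Sum_any_single[of "- p - 1"]) (auto simp: delta02_coeff_def)
    done
qed

lemma delta02_emono:
  "fmono X0 (- 1) \<star> fdelta (\<lambda>n. powers_of (- fexp log1m) (ratio E1 E2) n \<star> ratio E2 (fmono X0) n)
     = eseries 1 delta02_coeff"
proof -
  have neg: "fls_nth ((- fexp log1m) powi n) j = (- 1) powi n * pow1m_coeff n j" for n j
  proof -
    have "(- fexp log1m) powi n = (fls_const ((- 1) powi n)) * fexp log1m powi n"
      by (auto simp: power_int_minus_left)
    then show ?thesis by (simp add: fls_nth_exp_log1m_powi)
  qed
  show ?thesis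
    unfolding fmono_X0[of "-1" 1] powers_of_def fsubst_12
    apply (subst fmul_emonom_fdelta)
     apply (simp only: ratio_def fmono_X0[of _ 1] E2_emonom fmul_emonom fmul_emonom_right)
    apply (rule eseries_cong)
    subgoal for p q r
      by (subst Sum_any_single[of "- p - 1"]) (auto simp: delta02_coeff_def neg)
    done
qed

lemma delta12_fmono:
  "fmono X2 (- 1) \<star> fdelta (\<lambda>n. fdiff (fmono X1) (fmono X0) n \<star> fmono X2 (- n)) = eseries 0 delta12_coeff"
  unfolding fmono_X2
  apply (subst fmul_emonom_fdelta)
   apply (simp only: fdiff_X1_X0 fmul_emonom_right)
  apply (rule eseries_cong)
  subgoal for p q r
    by (subst Sum_any_single[of "- r - 1"]) (auto simp: delta12_coeff_def)
  done

lemma delta12_emono: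
  "E2 (- 1) \<star> fdelta (\<lambda>n. powers_of (fexp (- (- log1m))) (ratio (fmono X0) E1) n \<star> ratio E1 E2 n)
     = eseries 1 delta12_coeff"
  unfolding E2_emonom[of "- 1"] powers_of_def fsubst_01
  apply (subst fmul_emonom_fdelta)
   apply (simp only: ratio_def E1_emonom E2_emonom fmul_emonom fmul_emonom_right)
  apply (rule eseries_cong)
  subgoal for p q r
    by (subst Sum_any_single[of "- r - 1"]) (auto simp: delta12_coeff_def fls_nth_exp_log1m_powi)
  done

section \<open>Operator series\<close>

definition restrict_mono :: "fvar set \<Rightarrow> mono \<Rightarrow> mono" where
  "restrict_mono D m = (\<lambda>z. if z \<in> D then m z else 0)"

definition involves_only :: "fvar set \<Rightarrow> (mono \<Rightarrow> 'b::zero) \<Rightarrow> bool" where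
  "involves_only D A \<longleftrightarrow> (\<forall>m. A m \<noteq> 0 \<longrightarrow> (\<forall>z. z \<notin> D \<longrightarrow> m z = 0))"

text \<open>
  The powers of \<open>e\<^sup>t\<^sup>w x\<close> as a series to be substituted; with \<open>t = 0\<close> these are the powers of \<open>x\<close>,
  for any choice of \<open>w\<close>.
\<close>

definition evar :: "complex \<Rightarrow> fvar \<Rightarrow> fvar \<Rightarrow> int \<Rightarrow> complex fser" where
  "evar t x w n = (\<lambda>m. if m x = n \<and> (\<forall>z. z \<noteq> x \<and> z \<noteq> w \<longrightarrow> m z = 0)
                         then exp_coeff t n (m w) else 0)"

lemma emono_evar: "x \<noteq> w \<Longrightarrow> emono x w = evar 1 x w"
  by (rule ext) (simp add: emono_altdef evar_def)

lemma fmono_evar: "x \<noteq> w \<Longrightarrow> fmono x = evar 0 x w"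
  by (intro ext) (auto simp: fmono_def evar_def exp_coeff_zero_left fun_eq_iff)

context vertex_operator_algebra
begin

lemma Ycoeff_linear:
  "Ycoeff V (u + v) p c = Ycoeff V u p c + Ycoeff V v p c"
  "Ycoeff V (scl V r u) p c = scl V r (Ycoeff V u p c)"
  "Ycoeff V u p (c + d) = Ycoeff V u p c + Ycoeff V u p d"
  "Ycoeff V u p (scl V r c) = scl V r (Ycoeff V u p c)"
  using mode_linear_left mode_linear_right
  by (simp_all add: Ycoeff_def Vector_Spaces.linear_iff)

lemma Ycoeff_0 [simp]: "Ycoeff V 0 p c = 0" "Ycoeff V u p 0 = 0"
  using Ycoeff_linear(2)[of 0 0 p c] Ycoeff_linear(4)[of u p 0 0] by simp_all

lemma Ycoeff_truncation: "\<exists>N. \<forall>p<N. Ycoeff V u p c = 0"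
proof -
  obtain N where "\<forall>n\<ge>N. mode V u n c = 0" using truncation by blast
  then have "\<forall>p < - N. Ycoeff V u p c = 0" by (simp add: Ycoeff_def)
  then show ?thesis ..
qed

text \<open>
  If \<open>x\<close> and \<open>w\<close> do not occur in \<open>A\<close>, the exponent vector \<open>m\<close> determines which coefficient of \<open>A\<close> and
  which power of \<open>e\<^sup>t\<^sup>w x\<close> contribute.
\<close>

lemma subst_op_evar:
  assumes "x \<noteq> w" and A: "\<And>k. A k \<noteq> 0 \<Longrightarrow> k x = 0 \<and> k w = 0" and F: "\<And>n. F 0 n c = 0"
  shows "subst_op V F A (evar t x w) m c =
           scl V (exp_coeff t (m x) (m w)) (F (A (m(x := 0, w := 0))) (m x) c)"
proof -
  have "(case kn of (k, n) \<Rightarrow> scl V (evar t x w n (m - k)) (F (A k) n c)) = 0"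
    if "kn \<noteq> (m(x := 0, w := 0), m x)" for kn
  proof (rule ccontr)
    obtain k n where kn: "kn = (k, n)" by (cases kn)
    assume "(case kn of (k, n) \<Rightarrow> scl V (evar t x w n (m - k)) (F (A k) n c)) \<noteq> 0"
    then have "evar t x w n (m - k) \<noteq> 0" "A k \<noteq> 0"
      using F by (auto simp: kn)
    then have "m x - k x = n" "\<forall>z. z \<noteq> x \<and> z \<noteq> w \<longrightarrow> m z = k z" "k x = 0" "k w = 0"
      using A[of k] by (auto simp: evar_def split: if_splits)
    then have "k = m(x := 0, w := 0)" "n = m x"
      by (auto simp: fun_upd_def)
    then show False using that by (simp add: kn)
  qed
  then show ?thesis
    unfolding subst_op_def using \<open>x \<noteq> w\<close>
    by (subst Sum_any_single[of "(m(x := 0, w := 0), m x)"]) (auto simp: evar_def)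
qed

text \<open>
  Operator series in disjoint sets of variables: the sum in the composition has a single term.
\<close>

lemma comp_op_disjoint:
  assumes S: "\<And>m c z. z \<notin> D \<Longrightarrow> m z \<noteq> 0 \<Longrightarrow> S m c = 0" "\<And>m. S m 0 = 0"
    and T: "\<And>m c z. z \<notin> D' \<Longrightarrow> m z \<noteq> 0 \<Longrightarrow> T m c = 0" and D: "D \<inter> D' = {}"
  shows "(S \<odot> T) m c = (if \<forall>z. z \<notin> D \<union> D' \<longrightarrow> m z = 0 then S (restrict_mono D m) (T (restrict_mono D' m) c) else 0)"
proof -
  have k: "k = restrict_mono D' m \<and> (\<forall>z. z \<notin> D \<union> D' \<longrightarrow> m z = 0)" if "S (m - k) (T k c) \<noteq> 0" for k
  proof -
    have *: "k z = 0" if "z \<notin> D'" for z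
      using T[OF that, of k] S(2) \<open>S (m - k) (T k c) \<noteq> 0\<close> by metis
    have "m z - k z = 0" if "z \<notin> D" for z
      using S(1)[OF that, of "m - k"] \<open>S (m - k) (T k c) \<noteq> 0\<close> by auto
    moreover have "z \<notin> D" if "z \<in> D'" for z using D that by auto
    ultimately show ?thesis using * by (auto simp: restrict_mono_def fun_eq_iff)
  qed
  have "(S \<odot> T) m c = S (m - restrict_mono D' m) (T (restrict_mono D' m) c)"
    unfolding comp_op_def by (rule Sum_any_single) (use k in blast)
  moreover have "m - restrict_mono D' m = restrict_mono D m" if "\<forall>z. z \<notin> D \<union> D' \<longrightarrow> m z = 0"
    using that D by (auto simp: restrict_mono_def fun_eq_iff)
  ultimately show ?thesis using k by metis
qed

text \<open>
  What \<open>Y(u, x)\<close> and \<open>X(u, x)\<close> have in common: the coefficients are bilinear in \<open>u\<close> and the argument,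
  and only finitely many negative powers of \<open>x\<close> survive application to a vector.
\<close>

definition op_family :: "('v \<Rightarrow> int \<Rightarrow> 'v \<Rightarrow> 'v) \<Rightarrow> bool" where
  "op_family F \<longleftrightarrow> (\<forall>u v n c. F (u + v) n c = F u n c + F v n c) \<and>
     (\<forall>u n r c. F (scl V r u) n c = scl V r (F u n c)) \<and>
     (\<forall>u n c d. F u n (c + d) = F u n c + F u n d) \<and>
     (\<forall>u n r c. F u n (scl V r c) = scl V r (F u n c)) \<and>
     (\<forall>u c. \<exists>N. \<forall>n<N. F u n c = 0)"

lemma op_family_Ycoeff: "op_family (Ycoeff V)"
  by (simp add: op_family_def Ycoeff_linear Ycoeff_truncation)

lemma op_family_add:
  assumes "op_family F"
  shows "F (u + v) n c = F u n c + F v n c" "F u n (c + d) = F u n c + F u n d"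
  using assms by (auto simp: op_family_def)

lemma op_family_scl:
  assumes "op_family F"
  shows "F (scl V r u) n c = scl V r (F u n c)" "F u n (scl V r c) = scl V r (F u n c)"
  using assms by (auto simp: op_family_def)

lemma op_family_0:
  assumes "op_family F" shows "F 0 n c = 0" "F u n 0 = 0"
  using op_family_add(1)[OF assms, of 0 0 n c] op_family_add(2)[OF assms, of u n 0 0] by simp_all

lemma op_family_truncation: "op_family F \<Longrightarrow> \<exists>N. \<forall>n<N. F u n c = 0"
  by (auto simp: op_family_def)

lemma comp_op_evar:
  assumes F: "op_family F" and A: "involves_only {y} A" and B: "involves_only {y'} B"
    and d: "distinct [x, w, y, x', w', y']"
  shows "(subst_op V F A (evar t x w) \<odot> subst_op V F B (evar t x' w')) m c =
     (if \<forall>z. z \<notin> {x, w, y, x', w', y'} \<longrightarrow> m z = 0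
      then scl V (exp_coeff t (m x) (m w) * exp_coeff t (m x') (m w'))
             (F (A (restrict_mono {y} m)) (m x) (F (B (restrict_mono {y'} m)) (m x') c)) else 0)"
proof -
  have A': "A k \<noteq> 0 \<Longrightarrow> k x = 0 \<and> k w = 0" and B': "B k \<noteq> 0 \<Longrightarrow> k x' = 0 \<and> k w' = 0" for k
    using A B d by (auto simp: involves_only_def)
  have S: "subst_op V F A (evar t x w) m c =
      scl V (exp_coeff t (m x) (m w)) (F (A (m(x := 0, w := 0))) (m x) c)" for m c
    using subst_op_evar[of x w A F] A' d op_family_0[OF F] by simp
  have T: "subst_op V F B (evar t x' w') m c =
      scl V (exp_coeff t (m x') (m w')) (F (B (m(x' := 0, w' := 0))) (m x') c)" for m c
    using subst_op_evar[of x' w' B F] B' d op_family_0[OF F] by simp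
  have A0: "A (m(x := 0, w := 0)) = 0" if "z \<notin> {x, w, y}" "m z \<noteq> 0" for m z
    using A that unfolding involves_only_def by (metis fun_upd_other insertCI singletonD)
  have B0: "B (m(x' := 0, w' := 0)) = 0" if "z \<notin> {x', w', y'}" "m z \<noteq> 0" for m z
    using B that unfolding involves_only_def by (metis fun_upd_other insertCI singletonD)
  have r: "(restrict_mono {x, w, y} m)(x := 0, w := 0) = restrict_mono {y} m"
     "(restrict_mono {x', w', y'} m)(x' := 0, w' := 0) = restrict_mono {y'} m" for m
    using d by (auto simp: restrict_mono_def fun_eq_iff)
  have "{x, w, y} \<union> {x', w', y'} = {x, w, y, x', w', y'}" by auto
  moreover have "(subst_op V F A (evar t x w) \<odot> subst_op V F B (evar t x' w')) m c =
     (if \<forall>z. z \<notin> {x, w, y} \<union> {x', w', y'} \<longrightarrow> m z = 0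
      then subst_op V F A (evar t x w) (restrict_mono {x, w, y} m)
        (subst_op V F B (evar t x' w') (restrict_mono {x', w', y'} m) c) else 0)"
    by (rule comp_op_disjoint) (use d in \<open>auto simp: S T A0 B0 op_family_0[OF F]\<close>)
  moreover have "restrict_mono {x, w, y} m x = m x" "restrict_mono {x, w, y} m w = m w"
    "restrict_mono {x', w', y'} m x' = m x'" "restrict_mono {x', w', y'} m w' = m w'"
    by (simp_all add: restrict_mono_def)
  ultimately show ?thesis
    by (simp only: S T r op_family_scl[OF F] scale_scale)
qed

lemma comp_op_12:
  assumes "op_family F" and "involves_only {Y1} A" and "involves_only {Y2} B"
  shows "(subst_op V F A (evar t X1 W1) \<odot> subst_op V F B (evar t X2 W2)) m c =
     scl V (wcoeff t m) (if m X0 = 0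
       then F (A (restrict_mono {Y1} m)) (m X1) (F (B (restrict_mono {Y2} m)) (m X2) c) else 0)"
  using assms by (subst comp_op_evar) (auto simp: all_fvar wcoeff_def)

lemma comp_op_21:
  assumes "op_family F" and "involves_only {Y1} A" and "involves_only {Y2} B"
  shows "(subst_op V F B (evar t X2 W2) \<odot> subst_op V F A (evar t X1 W1)) m c =
     scl V (wcoeff t m) (if m X0 = 0
       then F (B (restrict_mono {Y2} m)) (m X2) (F (A (restrict_mono {Y1} m)) (m X1) c) else 0)"
  using assms by (subst comp_op_evar) (auto simp: all_fvar wcoeff_def mult.commute)

lemma scale_op_eseries:
  assumes T: "\<And>m. T m c = scl V (wcoeff t m) (\<tau> (exps m) (m Y1) (m Y2))"
    and fin: "finite {e. \<phi> e \<noteq> 0 \<and> \<tau> (exps m - e) (m Y1) (m Y2) \<noteq> 0}"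
  shows "scale_op V (eseries t \<phi>) T m c =
     scl V (wcoeff t m) (Sum_any (\<lambda>e. scl V (\<phi> e) (\<tau> (exps m - e) (m Y1) (m Y2))))"
  unfolding scale_op_def T using eseries_convolution[where \<tau> = \<tau> and \<phi> = \<phi>, OF vector_space_axioms fin] .

text \<open>
  The next three lemmas reduce a delta function times an operator series to a sum over one natural
  number \<open>j\<close>, the exponent of the second summand in the binomial expansion. The truncation hypothesis
  makes the sum finite.
\<close>

lemma delta01_sum:
  fixes p0 p1 p2 :: int
  assumes f: "\<And>q r. r < N \<Longrightarrow> f q r = 0"
  defines "g \<equiv> \<lambda>e. case (p0, p1, p2) - e of (p, q, r) \<Rightarrow> if p = 0 then f q r else 0"
  shows "finite {e. delta01_coeff e \<noteq> 0 \<and> g e \<noteq> 0}"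
    and "Sum_any (\<lambda>e. scl V (delta01_coeff e) (g e)) =
      Sum_any (\<lambda>j::nat. scl V ((- 1) ^ j * (of_int (- p0 - 1) gchoose j)) (f (p1 + p0 + 1 + int j) (p2 - int j)))"
proof -
  define h where "h = (\<lambda>j::nat. (p0, - p0 - 1 - int j, int j))"
  have sub: "{e. delta01_coeff e \<noteq> 0 \<and> g e \<noteq> 0} \<subseteq> h ` {j. int j \<le> p2 - N}"
  proof safe
    fix p q r assume "delta01_coeff (p, q, r) \<noteq> 0" "g (p, q, r) \<noteq> 0"
    then have "p = p0" "p + q + r = - 1" "r \<ge> 0" "\<not> p2 - r < N"
      using f by (auto simp: delta01_coeff_def g_def pow1m_coeff_def split: if_splits)
    then show "(p, q, r) \<in> h ` {j. int j \<le> p2 - N}"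
      by (intro image_eqI[of _ _ "nat r"]) (auto simp: h_def)
  qed
  show "finite {e. delta01_coeff e \<noteq> 0 \<and> g e \<noteq> 0}"
    by (rule finite_subset[OF sub], rule finite_imageI, rule finite_subset[of _ "{..nat (p2 - N)}"]) auto
  have "Sum_any (\<lambda>e. scl V (delta01_coeff e) (g e)) = Sum_any (\<lambda>j. scl V (delta01_coeff (h j)) (g (h j)))"
    by (rule Sum_any_reindex_inj) (use sub in \<open>auto simp: inj_def h_def\<close>)
  also have "\<dots> = Sum_any (\<lambda>j::nat. scl V ((- 1) ^ j * (of_int (- p0 - 1) gchoose j)) (f (p1 + p0 + 1 + int j) (p2 - int j)))"
    by (rule Sum_any.cong) (simp add: h_def g_def delta01_coeff_def pow1m_coeff_def algebra_simps)
  finally show "Sum_any (\<lambda>e. scl V (delta01_coeff e) (g e)) = \<dots>" .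
qed

lemma delta02_sum:
  fixes p0 p1 p2 :: int
  assumes f: "\<And>q r. q < N \<Longrightarrow> f q r = 0"
  defines "g \<equiv> \<lambda>e. case (p0, p1, p2) - e of (p, q, r) \<Rightarrow> if p = 0 then f q r else 0"
  shows "finite {e. delta02_coeff e \<noteq> 0 \<and> g e \<noteq> 0}"
    and "Sum_any (\<lambda>e. scl V (delta02_coeff e) (g e)) =
      Sum_any (\<lambda>j::nat. scl V ((- 1) powi (- p0 - 1) * ((- 1) ^ j * (of_int (- p0 - 1) gchoose j)))
        (f (p1 - int j) (p2 + p0 + 1 + int j)))"
proof -
  define h where "h = (\<lambda>j::nat. (p0, int j, - p0 - 1 - int j))"
  have sub: "{e. delta02_coeff e \<noteq> 0 \<and> g e \<noteq> 0} \<subseteq> h ` {j. int j \<le> p1 - N}"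
  proof safe
    fix p q r assume "delta02_coeff (p, q, r) \<noteq> 0" "g (p, q, r) \<noteq> 0"
    then have "p = p0" "p + q + r = - 1" "q \<ge> 0" "\<not> p1 - q < N"
      using f by (auto simp: delta02_coeff_def g_def pow1m_coeff_def split: if_splits)
    then show "(p, q, r) \<in> h ` {j. int j \<le> p1 - N}"
      by (intro image_eqI[of _ _ "nat q"]) (auto simp: h_def)
  qed
  show "finite {e. delta02_coeff e \<noteq> 0 \<and> g e \<noteq> 0}"
    by (rule finite_subset[OF sub], rule finite_imageI, rule finite_subset[of _ "{..nat (p1 - N)}"]) auto
  have "Sum_any (\<lambda>e. scl V (delta02_coeff e) (g e)) = Sum_any (\<lambda>j. scl V (delta02_coeff (h j)) (g (h j)))"
    by (rule Sum_any_reindex_inj) (use sub in \<open>auto simp: inj_def h_def\<close>)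
  also have "\<dots> = Sum_any (\<lambda>j::nat. scl V ((- 1) powi (- p0 - 1) * ((- 1) ^ j * (of_int (- p0 - 1) gchoose j)))
        (f (p1 - int j) (p2 + p0 + 1 + int j)))"
    by (rule Sum_any.cong) (simp add: h_def g_def delta02_coeff_def pow1m_coeff_def algebra_simps)
  finally show "Sum_any (\<lambda>e. scl V (delta02_coeff e) (g e)) = \<dots>" .
qed

text \<open>
  The parameter \<open>d\<close> covers the two forms of the iterate. In the Jacobi axiom \<open>x\<^sub>1\<close> does not occur in
  \<open>Y(Y(u, x\<^sub>0)v, x\<^sub>2)\<close>, so \<open>d = 0\<close>; in the theorem \<open>x\<^sub>0\<close> occurs only in the ratio of \<open>x\<^sub>0\<close> to \<open>e\<^sup>w\<^sup>1 x\<^sub>1\<close>,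
  so the exponents of \<open>x\<^sub>0\<close> and \<open>x\<^sub>1\<close> are opposite and \<open>d = -1\<close>.
\<close>

lemma delta12_sum:
  fixes p0 p1 p2 d :: int
  assumes f: "\<And>p r. p < N \<Longrightarrow> f p r = 0"
  defines "g \<equiv> \<lambda>e. case (p0, p1, p2) - e of (p, q, r) \<Rightarrow> if q = d * p then f p r else 0"
    and "s \<equiv> \<lambda>j::nat. p1 + int j - d * (p0 - int j)"
  shows "finite {e. delta12_coeff e \<noteq> 0 \<and> g e \<noteq> 0}"
    and "Sum_any (\<lambda>e. scl V (delta12_coeff e) (g e)) =
      Sum_any (\<lambda>j::nat. scl V ((- 1) ^ j * (of_int (s j) gchoose j)) (f (p0 - int j) (p2 + 1 + s j)))"
proof -
  define h where "h = (\<lambda>j::nat. (int j, p1 - d * (p0 - int j), - 1 - s j))"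
  have sub: "{e. delta12_coeff e \<noteq> 0 \<and> g e \<noteq> 0} \<subseteq> h ` {j. int j \<le> p0 - N}"
  proof safe
    fix p q r assume "delta12_coeff (p, q, r) \<noteq> 0" "g (p, q, r) \<noteq> 0"
    then have "p1 - q = d * (p0 - p)" "p + q + r = - 1" "p \<ge> 0" "\<not> p0 - p < N"
      using f by (auto simp: delta12_coeff_def g_def pow1m_coeff_def split: if_splits)
    then show "(p, q, r) \<in> h ` {j. int j \<le> p0 - N}"
      by (intro image_eqI[of _ _ "nat p"]) (auto simp: h_def s_def)
  qed
  show "finite {e. delta12_coeff e \<noteq> 0 \<and> g e \<noteq> 0}"
    by (rule finite_subset[OF sub], rule finite_imageI, rule finite_subset[of _ "{..nat (p0 - N)}"]) auto
  have "Sum_any (\<lambda>e. scl V (delta12_coeff e) (g e)) = Sum_any (\<lambda>j. scl V (delta12_coeff (h j)) (g (h j)))"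
    by (rule Sum_any_reindex_inj) (use sub in \<open>auto simp: inj_def h_def\<close>)
  also have "\<dots> = Sum_any (\<lambda>j::nat. scl V ((- 1) ^ j * (of_int (s j) gchoose j)) (f (p0 - int j) (p2 + 1 + s j)))"
    by (rule Sum_any.cong) (simp add: h_def g_def delta12_coeff_def pow1m_coeff_def s_def algebra_simps)
  finally show "Sum_any (\<lambda>e. scl V (delta12_coeff e) (g e)) = \<dots>" .
qed

section \<open>The three terms of the Jacobi identity\<close>

lemma scale_op_delta01:
  assumes F: "op_family F" and A: "involves_only {Y1} A" and B: "involves_only {Y2} B"
  defines "a \<equiv> \<lambda>m. F (A (restrict_mono {Y1} m))" and "b \<equiv> \<lambda>m. F (B (restrict_mono {Y2} m))"
  shows "scale_op V (eseries t delta01_coeff)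
      (subst_op V F A (evar t X1 W1) \<odot> subst_op V F B (evar t X2 W2)) m c =
    scl V (wcoeff t m) (Sum_any (\<lambda>j::nat. scl V ((- 1) ^ j * (of_int (- m X0 - 1) gchoose j))
      (a m (m X1 + m X0 + 1 + int j) (b m (m X2 - int j) c))))"
proof -
  have r: "restrict_mono {y} m = (\<lambda>_. 0)(y := m y)" for y m
    by (auto simp: restrict_mono_def)
  obtain N where N: "\<And>n. n < N \<Longrightarrow> b m n c = 0"
    using op_family_truncation[OF F] unfolding b_def by meson
  let ?f = "\<lambda>q r. a m q (b m r c)"
  let ?\<tau> = "\<lambda>e y1 y2. case e of (p, q, r) \<Rightarrow>
     if p = 0 then F (A ((\<lambda>_. 0)(Y1 := y1))) q (F (B ((\<lambda>_. 0)(Y2 := y2))) r c) else 0"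
  have \<tau>: "?\<tau> e (m Y1) (m Y2) = (case e of (p, q, r) \<Rightarrow> if p = 0 then ?f q r else 0)" for e
    by (cases e) (simp add: a_def b_def r)
  have f: "?f q r = 0" if "r < N" for q r
    using N[OF that] op_family_0[OF F] by (simp add: a_def)
  note D = delta01_sum[where f = ?f and N = N and ?p0.0 = "m X0" and ?p1.0 = "m X1" and ?p2.0 = "m X2", OF f]
  have fin: "finite {e. delta01_coeff e \<noteq> 0 \<and> ?\<tau> (exps m - e) (m Y1) (m Y2) \<noteq> 0}"
    unfolding \<tau> exps_def using D(1) by simp
  show ?thesis
    by (subst scale_op_eseries[where \<tau> = ?\<tau>])
      (simp add: comp_op_12[OF F A B] exps_def r, rule fin, simp only: \<tau>, simp only: exps_def D(2))
qed

lemma scale_op_delta02: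
  assumes F: "op_family F" and A: "involves_only {Y1} A" and B: "involves_only {Y2} B"
  defines "a \<equiv> \<lambda>m. F (A (restrict_mono {Y1} m))" and "b \<equiv> \<lambda>m. F (B (restrict_mono {Y2} m))"
  shows "scale_op V (eseries t delta02_coeff)
      (subst_op V F B (evar t X2 W2) \<odot> subst_op V F A (evar t X1 W1)) m c =
    scl V (wcoeff t m) (Sum_any (\<lambda>j::nat.
      scl V ((- 1) powi (- m X0 - 1) * ((- 1) ^ j * (of_int (- m X0 - 1) gchoose j)))
      (b m (m X2 + m X0 + 1 + int j) (a m (m X1 - int j) c))))"
proof -
  have r: "restrict_mono {y} m = (\<lambda>_. 0)(y := m y)" for y m
    by (auto simp: restrict_mono_def)
  obtain N where N: "\<And>n. n < N \<Longrightarrow> a m n c = 0"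
    using op_family_truncation[OF F] unfolding a_def by meson
  let ?f = "\<lambda>q r. b m r (a m q c)"
  let ?\<tau> = "\<lambda>e y1 y2. case e of (p, q, r) \<Rightarrow>
     if p = 0 then F (B ((\<lambda>_. 0)(Y2 := y2))) r (F (A ((\<lambda>_. 0)(Y1 := y1))) q c) else 0"
  have \<tau>: "?\<tau> e (m Y1) (m Y2) = (case e of (p, q, r) \<Rightarrow> if p = 0 then ?f q r else 0)" for e
    by (cases e) (simp add: a_def b_def r)
  have f: "?f q r = 0" if "q < N" for q r
    using N[OF that] op_family_0[OF F] by (simp add: b_def)
  note D = delta02_sum[where f = ?f and N = N and ?p0.0 = "m X0" and ?p1.0 = "m X1" and ?p2.0 = "m X2", OF f]
  have fin: "finite {e. delta02_coeff e \<noteq> 0 \<and> ?\<tau> (exps m - e) (m Y1) (m Y2) \<noteq> 0}"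
    unfolding \<tau> exps_def using D(1) by simp
  show ?thesis
    by (subst scale_op_eseries[where \<tau> = ?\<tau>])
      (simp add: comp_op_21[OF F A B] exps_def r, rule fin, simp only: \<tau>, simp only: exps_def D(2))
qed

lemma scale_op_delta12:
  assumes F: "op_family F"
    and B: "\<And>m. B m = scl V (exp_coeff t (m X1) (m W1))
        (if m X1 = d * m X0 \<and> m X2 = 0 \<and> m W2 = 0 then g (m X0) (m Y1) (m Y2) else 0)"
    and g: "\<And>p. p < N \<Longrightarrow> g p (m Y1) (m Y2) = 0"
  defines "s \<equiv> \<lambda>j::nat. m X1 + int j - d * (m X0 - int j)"
  shows "scale_op V (eseries t delta12_coeff) (subst_op V F B (evar t X2 W2)) m c =
    scl V (wcoeff t m) (Sum_any (\<lambda>j::nat. scl V ((- 1) ^ j * (of_int (s j) gchoose j))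
      (F (g (m X0 - int j) (m Y1) (m Y2)) (m X2 + 1 + s j) c)))"
proof -
  let ?f = "\<lambda>p r. F (g p (m Y1) (m Y2)) r c"
  let ?\<tau> = "\<lambda>e y1 y2. case e of (p, q, r) \<Rightarrow> if q = d * p then F (g p y1 y2) r c else 0"
  have f: "?f p r = 0" if "p < N" for p r
    using g[OF that] op_family_0[OF F] by simp
  note D = delta12_sum[where f = ?f and N = N and d = d and ?p0.0 = "m X0" and ?p1.0 = "m X1"
      and ?p2.0 = "m X2", OF f]
  have fin: "finite {e. delta12_coeff e \<noteq> 0 \<and> ?\<tau> (exps m - e) (m Y1) (m Y2) \<noteq> 0}"
    unfolding exps_def using D(1) by simp
  have B0: "B k \<noteq> 0 \<Longrightarrow> k X2 = 0 \<and> k W2 = 0" for k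
    by (auto simp: B split: if_splits)
  have T: "subst_op V F B (evar t X2 W2) k c = scl V (wcoeff t k) (?\<tau> (exps k) (k Y1) (k Y2))" for k
  proof -
    have "subst_op V F B (evar t X2 W2) k c =
        scl V (exp_coeff t (k X2) (k W2)) (F (B (k(X2 := 0, W2 := 0))) (k X2) c)"
      by (rule subst_op_evar) (simp_all add: B0 op_family_0[OF F])
    then show ?thesis
      by (simp add: B op_family_0[OF F] op_family_scl[OF F] exps_def wcoeff_def mult.commute)
  qed
  show ?thesis
    by (subst scale_op_eseries[where \<tau> = ?\<tau>])
      (rule T, rule fin, simp only: exps_def D(2) s_def)
qed

lemma involves_only_vconst: "involves_only D (vconst u)"
  by (auto simp: involves_only_def vconst_def)

text \<open>
  The coefficient of \<open>x\<^sub>0\<^sup>p x\<^sub>1\<^sup>q x\<^sub>2\<^sup>r\<close> in the Jacobi identity. All series are read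
  with \<open>t = 0\<close>, at exponent 0 of the variables \<open>w\<^sub>1, w\<^sub>2, y\<^sub>1, y\<^sub>2\<close>, which do not occur in it.
\<close>

lemma borcherds_identity:
  "Sum_any (\<lambda>j::nat. scl V ((- 1) ^ j * (of_int (- p - 1) gchoose j))
       (Ycoeff V u (q + p + 1 + int j) (Ycoeff V v (r - int j) c)))
   - Sum_any (\<lambda>j::nat. scl V ((- 1) powi (- p - 1) * ((- 1) ^ j * (of_int (- p - 1) gchoose j)))
       (Ycoeff V v (r + p + 1 + int j) (Ycoeff V u (q - int j) c)))
   = Sum_any (\<lambda>j::nat. scl V ((- 1) ^ j * (of_int (q + int j) gchoose j))
       (Ycoeff V (Ycoeff V u (p - int j) v) (r + 1 + (q + int j)) c))"
proof -
  define m where "m = monomial (p, q, r) 0 0"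
  have m: "m X0 = p" "m X1 = q" "m X2 = r" "m Y1 = 0" "m Y2 = 0" "wcoeff 0 m = 1"
    by (simp_all add: m_def wcoeff_def)
  have rm: "restrict_mono {Y1} m = (\<lambda>_. 0)" "restrict_mono {Y2} m = (\<lambda>_. 0)"
    by (auto simp: restrict_mono_def m)
  have Yop: "Yop V A Z = subst_op V (Ycoeff V) A Z" for A Z
    by (simp add: Yop_def)
  \<comment> \<open>At \<open>t = 0\<close> the second variable of \<open>evar\<close> is arbitrary; for \<open>x\<^sub>0\<close> it is taken to be \<open>w\<^sub>1\<close>.\<close>
  have E: "fmono X1 = evar 0 X1 W1" "fmono X2 = evar 0 X2 W2" "fmono X0 = evar 0 X0 W1"
    by (simp_all add: fmono_evar)
  obtain N where N: "\<And>n. n < N \<Longrightarrow> Ycoeff V u n v = 0"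
    using Ycoeff_truncation by meson
  have 1: "scale_op V (eseries 0 delta01_coeff)
       (Yop V (vconst u) (fmono X1) \<odot> Yop V (vconst v) (fmono X2)) m c =
     Sum_any (\<lambda>j::nat. scl V ((- 1) ^ j * (of_int (- p - 1) gchoose j))
       (Ycoeff V u (q + p + 1 + int j) (Ycoeff V v (r - int j) c)))"
    unfolding Yop_def E
    by (subst scale_op_delta01[OF op_family_Ycoeff involves_only_vconst involves_only_vconst])
      (simp add: m rm vconst_def)
  have 2: "scale_op V (eseries 0 delta02_coeff)
       (Yop V (vconst v) (fmono X2) \<odot> Yop V (vconst u) (fmono X1)) m c =
     Sum_any (\<lambda>j::nat. scl V ((- 1) powi (- p - 1) * ((- 1) ^ j * (of_int (- p - 1) gchoose j)))
       (Ycoeff V v (r + p + 1 + int j) (Ycoeff V u (q - int j) c)))"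
    unfolding Yop_def E
    by (subst scale_op_delta02[OF op_family_Ycoeff involves_only_vconst involves_only_vconst])
      (simp add: m rm vconst_def)
  have B: "app_op (Yop V (vconst u) (fmono X0)) (vconst v) k = scl V (exp_coeff 0 (k X1) (k W1))
        (if k X1 = 0 * k X0 \<and> k X2 = 0 \<and> k W2 = 0
         then (if k Y1 = 0 \<and> k Y2 = 0 then Ycoeff V u (k X0) v else 0) else 0)" for k
  proof -
    have Y: "Yop V (vconst u) (fmono X0) k v =
        scl V (exp_coeff 0 (k X0) (k W1)) (Ycoeff V (vconst u (k(X0 := 0, W1 := 0))) (k X0) v)" for k v
      unfolding Yop_def E by (rule subst_op_evar) (auto simp: vconst_def split: if_splits)
    have v0: "vconst v k = (if k = (\<lambda>_. 0) then v else 0)" for k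
      by (simp add: vconst_def)
    have "app_op (Yop V (vconst u) (fmono X0)) (vconst v) k = Yop V (vconst u) (fmono X0) (k - (\<lambda>_. 0)) v"
      unfolding app_op_def by (subst Sum_any_single[of "\<lambda>_. 0"]) (auto simp: v0 Y)
    also have "\<dots> = scl V (exp_coeff 0 (k X0) (k W1)) (Ycoeff V (vconst u (k(X0 := 0, W1 := 0))) (k X0) v)"
      by (simp add: Y fun_diff_def)
    also have "vconst u (k(X0 := 0, W1 := 0)) =
        (if k X1 = 0 \<and> k X2 = 0 \<and> k W2 = 0 \<and> k Y1 = 0 \<and> k Y2 = 0 then u else 0)"
      by (simp add: vconst_def fun_eq_iff all_fvar)
    finally show ?thesis
      by (simp add: exp_coeff_zero_left)
  qed
  have 3: "scale_op V (eseries 0 delta12_coeff)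
       (Yop V (app_op (Yop V (vconst u) (fmono X0)) (vconst v)) (fmono X2)) m c =
     Sum_any (\<lambda>j::nat. scl V ((- 1) ^ j * (of_int (q + int j) gchoose j))
       (Ycoeff V (Ycoeff V u (p - int j) v) (r + 1 + (q + int j)) c))"
    unfolding Yop[of "app_op _ _"] E(2)
    by (subst scale_op_delta12[where d = 0 and N = N and g = "\<lambda>p y1 y2. if y1 = 0 \<and> y2 = 0 then Ycoeff V u p v else 0",
          OF op_family_Ycoeff B]) (simp_all add: m N)
  show ?thesis
    unfolding 1[symmetric] 2[symmetric] 3[symmetric]
    using fun_cong[OF fun_cong[OF jacobi[of u v]], of m c]
    by (simp only: delta01_fmono delta02_fmono delta12_fmono minus_apply)
qed

section \<open>Weights\<close>

text \<open>
  The commutator formula for \<open>L(0) = \<omega>\<^sub>1\<close>. It is the coefficient with \<open>p = -1\<close> and \<open>q = -2\<close> of the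
  Jacobi identity for \<open>\<omega>\<close> and \<open>v\<close>: there each of the two products contributes one term, and the
  iterate contributes only \<open>Y(L(-1)v, x)\<close> and \<open>Y(L(0)v, x)\<close>, because \<open>j - 2\<close> is a natural number less
  than \<open>j\<close> for all \<open>j \<ge> 2\<close>. The \<open>L(-1)\<close>-derivative property rewrites the first of these.
\<close>

lemma Lop_0_bracket: "Lop V 0 (Ycoeff V v p c) =
   Ycoeff V v p (Lop V 0 c) + Ycoeff V (Lop V 0 v) p c + scl V (of_int p) (Ycoeff V v p c)"
proof -
  have gch: "(of_int (- 2 + int j) gchoose j :: complex) = (if j = 0 then 1 else if j = 1 then - 1 else 0)" for j :: nat
  proof (cases "j \<ge> 2")
    case True
    then have "of_int (- 2 + int j) = (of_nat (j - 2) :: complex)" by (simp add: of_nat_diff)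
    moreover have "(j - 2) choose j = 0" using True by (intro binomial_eq_0) auto
    ultimately show ?thesis using True
      by (metis binomial_gbinomial of_nat_0 One_nat_def not_numeral_le_zero numeral_le_one_iff semiring_norm(69))
  next
    case False
    then have "j = 0 \<or> j = 1" by auto
    then show ?thesis by auto
  qed
  have gch': "(of_nat j - 2 gchoose j :: complex) = (if j = 0 then 1 else if j = 1 then - 1 else 0)" for j :: nat
    using gch[of j] by simp
  have z: "(0::complex) gchoose j = 0" if "j > 0" for j :: nat
    using that by (cases j) simp_all
  let ?Y = "Ycoeff V (conf V)"
  have 1: "Sum_any (\<lambda>j::nat. scl V ((- 1) ^ j * (of_int (- (- 1) - 1) gchoose j))
       (?Y (- 2 + (- 1) + 1 + int j) (Ycoeff V v (p - int j) c))) = ?Y (- 2) (Ycoeff V v p c)"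
    by (subst Sum_any_single[of 0]) (auto simp: z)
  have 2: "Sum_any (\<lambda>j::nat. scl V ((- 1) powi (- (- 1) - 1) * ((- 1) ^ j * (of_int (- (- 1) - 1) gchoose j)))
       (Ycoeff V v (p + (- 1) + 1 + int j) (?Y (- 2 - int j) c))) = Ycoeff V v p (?Y (- 2) c)"
    by (subst Sum_any_single[of 0]) (auto simp: z)
  have "Sum_any (\<lambda>j::nat. scl V ((- 1) ^ j * (of_int (- 2 + int j) gchoose j))
       (Ycoeff V (?Y (- 1 - int j) v) (p + 1 + (- 2 + int j)) c)) =
     (\<Sum>j\<in>{0,1}. scl V ((- 1) ^ j * (of_int (- 2 + int j) gchoose j))
       (Ycoeff V (?Y (- 1 - int j) v) (p + 1 + (- 2 + int j)) c))"
    by (rule Sum_any.expand_superset) (auto simp: gch' split: if_splits)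
  also have "\<dots> = Ycoeff V (?Y (- 1) v) (p - 1) c + Ycoeff V (?Y (- 2) v) p c"
    by (simp add: gch' del: One_nat_def)
  finally have 3: "Sum_any (\<lambda>j::nat. scl V ((- 1) ^ j * (of_int (- 2 + int j) gchoose j))
       (Ycoeff V (?Y (- 1 - int j) v) (p + 1 + (- 2 + int j)) c)) =
      Ycoeff V (?Y (- 1) v) (p - 1) c + Ycoeff V (?Y (- 2) v) p c" .
  have L: "?Y (- 2) = Lop V 0" "?Y (- 1) = Lop V (- 1)"
    by (simp_all add: Ycoeff_def Lop_def fun_eq_iff)
  have "Lop V 0 (Ycoeff V v p c) - Ycoeff V v p (Lop V 0 c) =
      Ycoeff V (Lop V (- 1) v) (p - 1) c + Ycoeff V (Lop V 0 v) p c"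
    using borcherds_identity[of "- 1" "conf V" "- 2" v p c] unfolding 1 2 3 L .
  moreover have "Ycoeff V (Lop V (- 1) v) (p - 1) c = scl V (of_int p) (Ycoeff V v p c)"
    using derivative[of "p - 1" v c] by simp
  ultimately show ?thesis by (simp add: algebra_simps)
qed

lemma grade_0: "0 \<in> grade V n"
  using grade_subspace by (rule subspace_0)

lemma homog_props:
  shows homog_grade: "homog V v n \<in> grade V n"
    and finite_homog: "finite {n. homog V v n \<noteq> 0}"
    and Sum_any_homog: "Sum_any (homog V v) = v"
  using theI'[OF grade_direct_sum[of v]] by (simp_all add: homog_def)

text \<open>
  Uniqueness of the decomposition into homogeneous components; it makes \<open>homog\<close> linear and
  identifies the weight spaces with the eigenspaces of \<open>L(0)\<close>.
\<close>

lemma homog_eqI: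
  assumes "\<And>n. f n \<in> grade V n" and "finite {n. f n \<noteq> 0}" and "Sum_any f = v"
  shows "homog V v = f"
  using grade_direct_sum[of v] homog_props[of v] assms by blast

lemma homog_homogeneous: "v \<in> grade V n \<Longrightarrow> homog V v = (\<lambda>k. if k = n then v else 0)"
  by (rule homog_eqI) (auto simp: grade_0)

lemma homog_add: "homog V (u + v) = (\<lambda>n. homog V u n + homog V v n)"
proof (rule homog_eqI)
  have "{n. homog V u n + homog V v n \<noteq> 0} \<subseteq> {n. homog V u n \<noteq> 0} \<union> {n. homog V v n \<noteq> 0}"
    by auto
  then show "finite {n. homog V u n + homog V v n \<noteq> 0}"
    by (rule finite_subset) (simp add: finite_homog)
qed (auto simp: homog_grade Sum_any.distrib finite_homog Sum_any_homog intro: subspace_add[OF grade_subspace])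

lemma homog_scl: "homog V (scl V r v) = (\<lambda>n. scl V r (homog V v n))"
proof (rule homog_eqI)
  have "{n. scl V r (homog V v n) \<noteq> 0} \<subseteq> {n. homog V v n \<noteq> 0}" by auto
  then show "finite {n. scl V r (homog V v n) \<noteq> 0}"
    by (rule finite_subset) (simp add: finite_homog)
qed (auto simp: homog_grade Sum_any_scale Sum_any_homog intro: subspace_scale[OF grade_subspace])

lemma grade_induct [case_names homogeneous add]:
  assumes "\<And>n v. v \<in> grade V n \<Longrightarrow> P v" and "\<And>u v. P u \<Longrightarrow> P v \<Longrightarrow> P (u + v)"
  shows "P v"
proof -
  have "P (sum (homog V v) S)" if "finite S" for S
    using that by (induction S rule: finite_induct) (auto intro: assms grade_0 homog_grade)
  then show ?thesis
    using Sum_any_homog[of v] finite_homog[of v] by (metis Sum_any.expand_set)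
qed

lemma Lop_0_linear: "Lop V 0 (u + v) = Lop V 0 u + Lop V 0 v" "Lop V 0 (scl V r u) = scl V r (Lop V 0 u)"
  using mode_linear_right by (simp_all add: Lop_def Vector_Spaces.linear_iff)

text \<open>
  If \<open>L(0)v = kv\<close>, the components \<open>v\<^sub>n\<close> of \<open>v\<close> satisfy \<open>n v\<^sub>n = k v\<^sub>n\<close>, because \<open>L(0)v\<close> has
  the components \<open>n v\<^sub>n\<close> as well as \<open>k v\<^sub>n\<close>. Hence only \<open>v\<^sub>k\<close> is nonzero.
\<close>

lemma grade_if_Lop_0:
  assumes "Lop V 0 v = scl V (of_int k) v"
  shows "v \<in> grade V k"
proof -
  have s: "Lop V 0 (sum f S) = sum (\<lambda>n. Lop V 0 (f n)) S" if "finite S" for f and S :: "int set"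
    using that Lop_0_linear(2)[of 0 0]
    by (induction S rule: finite_induct) (simp_all add: Lop_0_linear)
  let ?f = "\<lambda>n. scl V (of_int n) (homog V v n)"
  have "homog V (Lop V 0 v) = ?f"
  proof (rule homog_eqI)
    have sub: "{n. ?f n \<noteq> 0} \<subseteq> {n. homog V v n \<noteq> 0}" by auto
    then show "finite {n. ?f n \<noteq> 0}"
      by (rule finite_subset) (rule finite_homog)
    have "Lop V 0 v = Lop V 0 (sum (homog V v) {n. homog V v n \<noteq> 0})"
      using Sum_any_homog[of v] by (simp add: Sum_any.expand_set)
    also have "\<dots> = sum ?f {n. homog V v n \<noteq> 0}"
      by (simp add: s finite_homog L0_grade[OF homog_grade])
    also have "\<dots> = Sum_any ?f"
      by (rule Sum_any.expand_superset[symmetric, OF finite_homog sub])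
    finally show "Sum_any ?f = Lop V 0 v" ..
  qed (auto simp: homog_grade intro: subspace_scale[OF grade_subspace])
  then have "scl V (of_int n) (homog V v n) = scl V (of_int k) (homog V v n)" for n
    unfolding assms homog_scl by metis
  then have "homog V v n = 0" if "n \<noteq> k" for n
    using that by auto
  then have "Sum_any (homog V v) = homog V v k"
    by (rule Sum_any_single)
  then show ?thesis using homog_grade[of v k] by (simp add: Sum_any_homog)
qed

lemma Ycoeff_grade:
  assumes "u \<in> grade V h" and "v \<in> grade V g"
  shows "Ycoeff V u p v \<in> grade V (h + g + p)"
  by (rule grade_if_Lop_0)
    (simp add: Lop_0_bracket L0_grade[OF assms(1)] L0_grade[OF assms(2)] Ycoeff_linear scale_left_distrib)

lemma Xcoeff_homogeneous: "v \<in> grade V h \<Longrightarrow> Xcoeff V v p c = Ycoeff V v (p - h) c"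
  unfolding Xcoeff_def by (subst Sum_any_single[of h]) (auto simp: homog_homogeneous)

lemma Xcoeff_finite: "finite {n. Ycoeff V (homog V v n) (p - n) c \<noteq> 0}"
  by (rule finite_subset[OF _ finite_homog[of v]]) auto

lemma op_family_Xcoeff: "op_family (Xcoeff V)"
proof -
  have "\<exists>N. \<forall>n<N. Xcoeff V v n c = 0" for v c
  proof (induction v rule: grade_induct)
    case (homogeneous h v)
    obtain N where "\<forall>p<N. Ycoeff V v p c = 0" using Ycoeff_truncation by blast
    then have "\<forall>n < N + h. Xcoeff V v n c = 0" by (simp add: Xcoeff_homogeneous[OF homogeneous])
    then show ?case ..
  next
    case (add u v)
    then obtain N M where "\<forall>n<N. Xcoeff V u n c = 0" "\<forall>n<M. Xcoeff V v n c = 0" by blast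
    then have "\<forall>n < min N M. Xcoeff V (u + v) n c = 0"
      using Xcoeff_finite by (simp add: Xcoeff_def homog_add Ycoeff_linear Sum_any.distrib)
    then show ?case ..
  qed
  then show ?thesis
    by (auto simp: op_family_def Xcoeff_def homog_add homog_scl Ycoeff_linear Sum_any.distrib
        Xcoeff_finite Sum_any_scale)
qed

end

section \<open>Composition of Laurent series\<close>

lemma fls_times_nth_Sum_any:
  fixes f g :: "'a::{comm_monoid_add, mult_zero} fls"
  shows "fls_nth (f * g) n = Sum_any (\<lambda>i. fls_nth f i * fls_nth g (n - i))"
proof -
  have "{i. fls_nth f i * fls_nth g (n - i) \<noteq> 0} \<subseteq> {fls_subdegree f..n - fls_subdegree g}"
  proof
    fix i assume "i \<in> {i. fls_nth f i * fls_nth g (n - i) \<noteq> 0}"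
    then have "fls_nth f i \<noteq> 0" "fls_nth g (n - i) \<noteq> 0" by auto
    then have "\<not> i < fls_subdegree f" "\<not> n - i < fls_subdegree g"
      using fls_eq0_below_subdegree by blast+
    then show "i \<in> {fls_subdegree f..n - fls_subdegree g}" by simp
  qed
  then show ?thesis
    unfolding fls_times_nth(2) by (intro Sum_any.expand_superset[symmetric]) simp_all
qed

lemma fls_times_fps_nth:
  fixes f :: "complex fps" and g :: "complex fls"
  assumes "\<And>i. i < n - int K \<Longrightarrow> fls_nth g i = 0"
  shows "fls_nth (fps_to_fls f * g) n = (\<Sum>i\<in>{..K}. fps_nth f i * fls_nth g (n - int i))"
proof -
  have "fls_nth (fps_to_fls f * g) n = Sum_any (\<lambda>i::nat. fps_nth f i * fls_nth g (n - int i))"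
    unfolding fls_times_nth_Sum_any
    by (subst Sum_any_reindex_inj[of int]) (auto simp: image_iff, metis nat_0_le not_less)
  also have "\<dots> = (\<Sum>i\<in>{..K}. fps_nth f i * fls_nth g (n - int i))"
    by (rule Sum_any.expand_superset) (auto intro: assms ccontr)
  finally show ?thesis .
qed

text \<open>
  The composition of \<open>F = X\<^sup>d f\<close> with \<open>G\<close> is defined as \<open>f(G) G\<^sup>d\<close>, whereas
  \<^const>\<open>fsubst\<close> and \<^const>\<open>subst_op\<close> are sums over the powers of the substituted series. The
  two agree: the order of \<open>G\<^sup>n\<close> is \<open>n\<close> times that of \<open>G\<close>, so in a fixed degree only finitely many
  powers \<open>G\<^sup>d, \<dots>, G\<^sup>d\<^sup>+\<^sup>K\<close> contribute.
\<close>

lemma fls_compose_fps_nth: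
  fixes F :: "complex fls" and G :: "complex fps"
  assumes G: "G \<noteq> 0" "fps_nth G 0 = 0"
  shows "fls_nth (fls_compose_fps F G) q = Sum_any (\<lambda>n. fls_nth F n * fls_nth (fps_to_fls G powi n) q)"
proof (cases "F = 0")
  case False
  define d where "d = fls_subdegree F"
  define f where "f = fls_base_factor_to_fps F"
  define s where "s = int (subdegree G)"
  have s: "s \<ge> 1" using G subdegree_pos_iff[of G] by (simp add: s_def)
  have van: "fls_nth (fps_to_fls G powi n) i = 0" if "i < n * s" for n i
    using that by (intro fls_eq0_below_subdegree) (simp add: fls_subdegree_fls_to_fps s_def)
  define K where "K = nat (q - d * s)"
  have van': "fls_nth (fps_to_fls G powi d) i = 0" if "i < q - int K" for i
    using that by (intro van) (auto simp: K_def split: if_splits)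
  have f: "fps_nth f k = fls_nth F (d + int k)" for k
    by (simp add: f_def d_def add.commute)
  have comp: "fps_nth (f oo G) i = (\<Sum>k\<in>{..K}. fps_nth f k * fps_nth (G ^ k) i)" if "i \<le> K" for i
    unfolding fps_compose_nth using that startsby_zero_power_prefix[OF G(2)]
    by (intro sum.mono_neutral_left) auto
  have pw: "fps_to_fls (G ^ k) * fps_to_fls G powi d = fps_to_fls G powi (d + int k)" for k
    using G by (simp add: fps_to_fls_power power_int_add mult.commute)
  have "fls_nth (fls_compose_fps F G) q = (\<Sum>i\<in>{..K}. fps_nth (f oo G) i * fls_nth (fps_to_fls G powi d) (q - int i))"
    unfolding fls_compose_fps_def d_def[symmetric] f_def[symmetric]
    by (rule fls_times_fps_nth) (rule van')
  also have "\<dots> = (\<Sum>i\<in>{..K}. \<Sum>k\<in>{..K}. fps_nth f k * (fps_nth (G ^ k) i * fls_nth (fps_to_fls G powi d) (q - int i)))"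
    by (simp add: comp sum_distrib_right mult.assoc)
  also have "\<dots> = (\<Sum>k\<in>{..K}. fps_nth f k * (\<Sum>i\<in>{..K}. fps_nth (G ^ k) i * fls_nth (fps_to_fls G powi d) (q - int i)))"
    by (subst sum.swap) (simp add: sum_distrib_left)
  also have "\<dots> = (\<Sum>k\<in>{..K}. fls_nth F (d + int k) * fls_nth (fps_to_fls G powi (d + int k)) q)"
    by (simp add: f fls_times_fps_nth[OF van', symmetric] pw)
  also have "\<dots> = Sum_any (\<lambda>n. fls_nth F n * fls_nth (fps_to_fls G powi n) q)" (is "_ = Sum_any ?g")
  proof -
    have "{n. ?g n \<noteq> 0} \<subseteq> (\<lambda>k. d + int k) ` {..K}"
    proof
      fix n assume "n \<in> {n. ?g n \<noteq> 0}"
      then have "\<not> n < d" "\<not> q < n * s"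
        using van[of q n] by (auto simp: d_def)
      moreover from this have "(n - d) * 1 \<le> (n - d) * s"
        using s by (intro mult_left_mono) auto
      ultimately have "nat (n - d) \<le> K"
        by (auto simp: K_def left_diff_distrib)
      then show "n \<in> (\<lambda>k. d + int k) ` {..K}"
        using \<open>\<not> n < d\<close> by (intro image_eqI[of _ _ "nat (n - d)"]) auto
    qed
    then have "Sum_any ?g = sum ?g ((\<lambda>k. d + int k) ` {..K})"
      by (intro Sum_any.expand_superset) auto
    then show ?thesis
      by (simp add: sum.reindex inj_on_def)
  qed
  finally show ?thesis .
qed simp

section \<open>The operators \<open>Y[a, -log(1 - z)]\<close>\<close>

definition expm1_powi :: "int \<Rightarrow> complex fls" where
  "expm1_powi p = fps_to_fls (fps_exp 1 - 1) powi p"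

definition neg_log1m_powi :: "int \<Rightarrow> complex fls" where
  "neg_log1m_powi n = fps_to_fls (- log1m) powi n"

text \<open>
  The series \<open>e\<^sup>h\<^sup>y (e\<^sup>y - 1)\<^sup>p\<close>, with which the coefficient of \<open>x\<^sup>p\<close> in \<open>Y(a, x)\<close> enters \<open>Y[a, y]\<close> if \<open>a\<close>
  has weight \<open>h\<close>.
\<close>

definition bracket_series :: "int \<Rightarrow> int \<Rightarrow> complex fls" where
  "bracket_series h p = fps_to_fls (fps_exp (of_int h)) * expm1_powi p"

lemma neg_log1m: "- log1m \<noteq> 0" "fps_nth (- log1m) 0 = 0" "subdegree (- log1m) = 1"
proof -
  have "fps_nth (- log1m) 1 = 1" by (simp add: log1m_def)
  then show "- log1m \<noteq> 0" by auto
  show "fps_nth (- log1m) 0 = 0" by (simp add: log1m_def)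
  show "subdegree (- log1m) = 1"
    by (rule subdegreeI) (simp_all add: log1m_def)
qed

lemma neg_log1m_powi_eq_0: "q < n \<Longrightarrow> fls_nth (neg_log1m_powi n) q = 0"
  unfolding neg_log1m_powi_def
  using neg_log1m(3) by (intro fls_eq0_below_subdegree) (simp add: fls_subdegree_fls_to_fps)

lemma expm1_powi_eq_0:
  assumes "j < p"
  shows "fls_nth (expm1_powi p) j = 0"
proof -
  have "subdegree (fps_exp 1 - 1 :: complex fps) = 1"
    by (rule subdegreeI) simp_all
  then have "fls_subdegree (fps_to_fls (fps_exp 1 - 1 :: complex fps)) = 1"
    by (simp only: fls_subdegree_fls_to_fps of_nat_1)
  then have "fls_subdegree (fps_to_fls (fps_exp 1 - 1 :: complex fps) powi p) = p"
    by (simp only: fls_subdegree_power_int mult_1_right)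
  then show ?thesis
    unfolding expm1_powi_def using assms by (intro fls_eq0_below_subdegree) (simp only:)
qed

text \<open>
  With \<open>y = -log(1 - z)\<close> one has \<open>e\<^sup>y = (1 - z)\<^sup>-\<^sup>1\<close> and \<open>e\<^sup>y - 1 = z (1 - z)\<^sup>-\<^sup>1\<close>, so that
  \<open>e\<^sup>h\<^sup>y (e\<^sup>y - 1)\<^sup>p\<close> becomes \<open>z\<^sup>p (1 - z)\<^sup>-\<^sup>h\<^sup>-\<^sup>p\<close>.
\<close>

lemma bracket_series_compose:
  "fls_compose_fps (bracket_series h p) (- log1m) = fls_shift (- p) (fexp log1m powi (- h - p))"
proof -
  have U: "fexp log1m = 1 - fls_X" "fexp log1m \<noteq> 0"
  proof -
    show *: "fexp log1m = 1 - fls_X" by (simp add: fexp_def exp_log1m)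
    have "fls_nth (1 - fls_X :: complex fls) 0 \<noteq> 0" by simp
    then show "fexp log1m \<noteq> 0" unfolding * by force
  qed
  have E: "fps_to_fls (fps_exp (of_int n)) = fps_to_fls (fps_exp (1::complex)) powi n" for n
  proof (cases "n \<ge> 0")
    case True
    then show ?thesis
      by (simp add: power_int_def fps_exp_power_mult flip: fps_to_fls_power)
  next
    case False
    have "fps_to_fls (fps_exp (of_int n)) * fps_to_fls (fps_exp (of_int (- n) :: complex)) = 1"
      by (simp flip: fls_times_fps_to_fls fps_exp_add_mult)
    then have "fps_to_fls (fps_exp (of_int n :: complex)) = inverse (fps_to_fls (fps_exp (of_int (- n))))"
      using inverse_unique by (metis mult.commute)
    with False show ?thesis
      by (simp add: power_int_def fps_exp_power_mult power_inverse flip: fps_to_fls_power)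
  qed
  have c: "fls_compose_fps (fps_to_fls (fps_exp 1)) (- log1m) = inverse (fexp log1m)"
  proof -
    have "(fps_exp 1 oo - log1m) * (fps_exp 1 oo log1m) = 1"
    proof -
      have "fps_exp 1 oo - log1m = fps_exp (- 1) oo log1m"
      proof -
        have "fps_exp (- 1 :: complex) = fps_exp 1 oo (- fps_X)"
          by simp
        also have "\<dots> oo log1m = fps_exp 1 oo ((- fps_X) oo log1m)"
          by (rule fps_compose_assoc[symmetric]) (simp_all add: log1m_def)
        finally show ?thesis by (simp add: fps_compose_uminus log1m_def)
      qed
      then show ?thesis
        by (simp add: log1m_def flip: fps_compose_mult_distrib fps_exp_add_mult)
    qed
    then have "fps_to_fls (fps_exp 1 oo - log1m) * fexp log1m = 1"
      by (simp add: fexp_def flip: fls_times_fps_to_fls)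
    then show ?thesis
      using neg_log1m inverse_unique by (metis fls_compose_fps_to_fls mult.commute)
  qed
  have "fls_compose_fps (bracket_series h p) (- log1m) =
      inverse (fexp log1m) powi h * (inverse (fexp log1m) - 1) powi p"
    unfolding bracket_series_def expm1_powi_def E
    using neg_log1m
    by (simp add: fls_compose_fps_mult fls_compose_fps_powi c fls_compose_fps_diff)
  also have "inverse (fexp log1m) - 1 = fls_X * inverse (fexp log1m)"
    using U by (simp add: field_simps)
  also have "inverse (fexp log1m) powi h * (fls_X * inverse (fexp log1m)) powi p =
     fls_X powi p * fexp log1m powi (- h - p)"
  proof -
    have iv: "inverse (fexp log1m) powi n = fexp log1m powi (- n)" for n
      by (simp add: power_int_minus power_int_inverse)
    have U_add: "fexp log1m powi (- h) * fexp log1m powi (- p) = fexp log1m powi (- h - p)"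
      using power_int_add[of "fexp log1m" "- h" "- p"] U(2) by simp
    show ?thesis
      by (simp only: power_int_mult_distrib iv mult.left_commute[of "fexp log1m powi (- h)"] U_add)
  qed
  finally show ?thesis
    by (simp add: fls_shifted_times_simps)
qed

lemma bracket_series_sum:
  "Sum_any (\<lambda>n. fls_nth (bracket_series h p) n * fls_nth (neg_log1m_powi n) q) = pow1m_coeff (- h - p) (q - p)"
  unfolding neg_log1m_powi_def fls_compose_fps_nth[OF neg_log1m(1,2), symmetric] bracket_series_compose
  by (simp add: fls_nth_exp_log1m_powi)

context vertex_operator_algebra
begin

lemma Lop_0_funpow: "a \<in> grade V h \<Longrightarrow> (Lop V 0 ^^ k) a = scl V (of_int h ^ k) a"
  by (induction k) (simp_all add: Lop_0_linear L0_grade mult.commute)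

lemma Lop_0_funpow_add: "(Lop V 0 ^^ k) (a + b) = (Lop V 0 ^^ k) a + (Lop V 0 ^^ k) b"
  by (induction k) (simp_all add: Lop_0_linear)

abbreviation Bcoeff_term :: "'v \<Rightarrow> int \<Rightarrow> 'v \<Rightarrow> nat \<times> int \<Rightarrow> 'v" where
  "Bcoeff_term a j c \<equiv> (\<lambda>(k, p). scl V (fls_nth (expm1_powi p) (j - int k) / fact k)
       (Ycoeff V ((Lop V 0 ^^ k) a) p c))"

text \<open>
  The power \<open>(e\<^sup>y - 1)\<^sup>p\<close> starts with \<open>y\<^sup>p\<close>, which bounds \<open>k + p\<close> by \<open>j\<close>, and \<open>p\<close> is bounded below by
  truncation. This lower bound is uniform in \<open>k\<close> for homogeneous \<open>a\<close>, since \<open>L(0)\<^sup>k a\<close> is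
  then a multiple of \<open>a\<close>.
\<close>

lemma Bcoeff_term_support:
  assumes "a \<in> grade V h" and "\<And>p. p < N \<Longrightarrow> Ycoeff V a p c = 0"
  shows "{kp. Bcoeff_term a j c kp \<noteq> 0} \<subseteq> {..nat (j - N)} \<times> {N..j}"
proof
  fix kp assume "kp \<in> {kp. Bcoeff_term a j c kp \<noteq> 0}"
  then obtain k p where kp: "kp = (k, p)" and "fls_nth (expm1_powi p) (j - int k) \<noteq> 0"
    "Ycoeff V a p c \<noteq> 0"
    by (cases kp) (auto simp: Lop_0_funpow[OF assms(1)] Ycoeff_linear)
  then have "\<not> j - int k < p" "\<not> p < N"
    using expm1_powi_eq_0 assms(2) by blast+
  then show "kp \<in> {..nat (j - N)} \<times> {N..j}" by (auto simp: kp)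
qed

lemma finite_Bcoeff_term: "finite {kp. Bcoeff_term a j c kp \<noteq> 0}"
proof (induction a rule: grade_induct)
  case (homogeneous h a)
  obtain N where "\<And>p. p < N \<Longrightarrow> Ycoeff V a p c = 0"
    using Ycoeff_truncation by meson
  from Bcoeff_term_support[OF homogeneous this] show ?case
    by (rule finite_subset) simp_all
next
  case (add a b)
  have "{kp. Bcoeff_term (a + b) j c kp \<noteq> 0} \<subseteq> {kp. Bcoeff_term a j c kp \<noteq> 0} \<union> {kp. Bcoeff_term b j c kp \<noteq> 0}"
    by (auto simp: Lop_0_funpow_add Ycoeff_linear scale_right_distrib)
  then show ?case
    by (rule finite_subset) (simp add: add)
qed

lemma Bcoeff_add:
  "Bcoeff V (a + b) j c = Bcoeff V a j c + Bcoeff V b j c"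
  "Bcoeff V a j (c + d) = Bcoeff V a j c + Bcoeff V a j d"
  unfolding Bcoeff_def expm1_powi_def[symmetric]
  by (simp_all only: Sum_any.distrib[OF finite_Bcoeff_term finite_Bcoeff_term, symmetric])
    (rule Sum_any.cong, simp add: case_prod_unfold Lop_0_funpow_add Ycoeff_linear scale_right_distrib)+

lemma Bcoeff_0: "Bcoeff V 0 j c = 0" "Bcoeff V a j 0 = 0"
  using Bcoeff_add(1)[of 0 0 j c] Bcoeff_add(2)[of a j 0 0] by simp_all

lemma Bcoeff_homogeneous:
  assumes a: "a \<in> grade V h" and N: "\<And>p. p < N \<Longrightarrow> Ycoeff V a p c = 0" and "j \<le> q"
  shows "Bcoeff V a j c = (\<Sum>p\<in>{N..q}. scl V (fls_nth (bracket_series h p) j) (Ycoeff V a p c))"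
proof -
  have K: "fls_nth (bracket_series h p) j =
      (\<Sum>k\<in>{..nat (j - N)}. (of_int h) ^ k / fact k * fls_nth (expm1_powi p) (j - int k))" if "p \<ge> N" for p
    unfolding bracket_series_def using that
    by (subst fls_times_fps_nth[where K = "nat (j - N)"])
      (auto intro!: expm1_powi_eq_0 split: if_splits)
  have "Bcoeff V a j c = sum (Bcoeff_term a j c) ({..nat (j - N)} \<times> {N..q})"
    unfolding Bcoeff_def expm1_powi_def[symmetric]
    by (rule Sum_any.expand_superset)
      (use Bcoeff_term_support[OF a N, where j = j] \<open>j \<le> q\<close> in \<open>simp, force\<close>)
  also have "\<dots> = (\<Sum>p\<in>{N..q}. \<Sum>k\<in>{..nat (j - N)}. Bcoeff_term a j c (k, p))"
    by (subst sum.swap) (simp add: sum.cartesian_product)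
  also have "\<dots> = (\<Sum>p\<in>{N..q}. scl V (fls_nth (bracket_series h p) j) (Ycoeff V a p c))"
    by (rule sum.cong) (auto simp: K scale_sum_left Lop_0_funpow[OF a] Ycoeff_linear mult.commute)
  finally show ?thesis .
qed

text \<open>
  The coefficient of \<open>z\<^sup>q\<close> in \<open>Y[a, -log(1 - z)]c\<close>.
\<close>

definition log_bracket :: "'v \<Rightarrow> int \<Rightarrow> 'v \<Rightarrow> 'v" where
  "log_bracket a q c = Sum_any (\<lambda>n. scl V (fls_nth (neg_log1m_powi n) q) (Bcoeff V a n c))"

lemma Bcoeff_truncation: "\<exists>N. \<forall>n<N. Bcoeff V a n c = 0"
proof (induction a rule: grade_induct)
  case (homogeneous h a)
  obtain N where N: "\<And>p. p < N \<Longrightarrow> Ycoeff V a p c = 0"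
    using Ycoeff_truncation by meson
  have "Bcoeff V a n c = 0" if "n < N" for n
    using that by (simp add: Bcoeff_homogeneous[OF homogeneous N order_refl])
  then show ?case by blast
next
  case (add a b)
  then obtain N M where "\<forall>n<N. Bcoeff V a n c = 0" "\<forall>n<M. Bcoeff V b n c = 0" by blast
  then have "\<forall>n < min N M. Bcoeff V (a + b) n c = 0"
    by (simp add: Bcoeff_add)
  then show ?case ..
qed

lemma finite_log_bracket: "finite {n. scl V (fls_nth (neg_log1m_powi n) q) (Bcoeff V a n c) \<noteq> 0}"
proof -
  obtain N where N: "\<And>n. n < N \<Longrightarrow> Bcoeff V a n c = 0"
    using Bcoeff_truncation by meson
  have "{n. scl V (fls_nth (neg_log1m_powi n) q) (Bcoeff V a n c) \<noteq> 0} \<subseteq> {N..q}"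
  proof
    fix n assume "n \<in> {n. scl V (fls_nth (neg_log1m_powi n) q) (Bcoeff V a n c) \<noteq> 0}"
    then have "\<not> n < N" "\<not> q < n"
      using N neg_log1m_powi_eq_0 by auto
    then show "n \<in> {N..q}" by simp
  qed
  then show ?thesis by (rule finite_subset) simp
qed

lemma log_bracket_add:
  "log_bracket (a + b) q c = log_bracket a q c + log_bracket b q c"
  "log_bracket a q (c + d) = log_bracket a q c + log_bracket a q d"
  unfolding log_bracket_def
  by (simp_all only: Sum_any.distrib[OF finite_log_bracket finite_log_bracket, symmetric] Bcoeff_add scale_right_distrib)

lemma log_bracket_0: "log_bracket 0 q c = 0" "log_bracket a q 0 = 0"
  by (simp_all add: log_bracket_def Bcoeff_0)

lemma log_bracket_truncation: "\<exists>N. \<forall>q<N. log_bracket a q c = 0"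
proof -
  obtain N where N: "\<And>n. n < N \<Longrightarrow> Bcoeff V a n c = 0"
    using Bcoeff_truncation by meson
  have "log_bracket a q c = 0" if "q < N" for q
  proof -
    have "scl V (fls_nth (neg_log1m_powi n) q) (Bcoeff V a n c) = 0" for n
      using N[of n] neg_log1m_powi_eq_0[of q n] that by (cases "n < N") simp_all
    then show ?thesis by (simp only: log_bracket_def Sum_any.neutral)
  qed
  then show ?thesis by blast
qed

lemma Bcoeff_below:
  assumes "a \<in> grade V h" and N: "\<And>p. p < N \<Longrightarrow> Ycoeff V a p c = 0" and "n < N"
  shows "Bcoeff V a n c = 0"
  using assms(3) by (simp add: Bcoeff_homogeneous[OF assms(1) N order_refl])

text \<open>
  By \<open>bracket_series_sum\<close>, the result is the coefficient of \<open>z\<^sup>q\<close> in \<open>(1 - z)\<^sup>-\<^sup>h Y(a, z/(1 - z))c\<close>: the sums over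
  the powers of \<open>y\<close> and over those of \<open>x\<close> in \<open>Y(a, x)\<close> both run within \<open>{N..M}\<close>, so they can be
  interchanged.
\<close>

lemma log_bracket_homogeneous:
  assumes a: "a \<in> grade V h" and N: "\<And>p. p < N \<Longrightarrow> Ycoeff V a p c = 0" and "q \<le> M"
  shows "log_bracket a q c = (\<Sum>p\<in>{N..M}. scl V (pow1m_coeff (- h - p) (q - p)) (Ycoeff V a p c))"
proof -
  let ?w = "\<lambda>n. fls_nth (neg_log1m_powi n) q"
  have sub: "{n. scl V (?w n) (Bcoeff V a n c) \<noteq> 0} \<subseteq> {N..M}"
  proof
    fix n assume "n \<in> {n. scl V (?w n) (Bcoeff V a n c) \<noteq> 0}"
    then have "?w n \<noteq> 0" "Bcoeff V a n c \<noteq> 0" by auto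
    then have "\<not> q < n" "\<not> n < N"
      using neg_log1m_powi_eq_0 Bcoeff_below[OF a N] by blast+
    then show "n \<in> {N..M}" using \<open>q \<le> M\<close> by simp
  qed
  have P: "pow1m_coeff (- h - p) (q - p) = (\<Sum>n\<in>{N..M}. ?w n * fls_nth (bracket_series h p) n)" if "p \<ge> N" for p
    unfolding bracket_series_sum[symmetric]
  proof (subst Sum_any.expand_superset[of "{N..M}"])
    show "{n. fls_nth (bracket_series h p) n * ?w n \<noteq> 0} \<subseteq> {N..M}"
    proof
      fix n assume "n \<in> {n. fls_nth (bracket_series h p) n * ?w n \<noteq> 0}"
      then have "?w n \<noteq> 0" "fls_nth (bracket_series h p) n \<noteq> 0" by auto
      moreover have "fls_nth (bracket_series h p) n = 0" if "n < p"
        unfolding bracket_series_def using that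
        by (subst fls_times_fps_nth[where K = 0]) (auto intro!: expm1_powi_eq_0)
      ultimately have "\<not> q < n" "\<not> n < p"
        using neg_log1m_powi_eq_0 by blast+
      then show "n \<in> {N..M}" using \<open>q \<le> M\<close> that by simp
    qed
  qed (simp_all add: mult.commute)
  have "log_bracket a q c = (\<Sum>n\<in>{N..M}. scl V (?w n) (Bcoeff V a n c))"
    unfolding log_bracket_def by (rule Sum_any.expand_superset[OF _ sub]) simp
  also have "\<dots> = (\<Sum>n\<in>{N..M}. \<Sum>p\<in>{N..M}. scl V (?w n * fls_nth (bracket_series h p) n) (Ycoeff V a p c))"
    by (rule sum.cong[OF refl]) (simp add: Bcoeff_homogeneous[OF a N, where q = M] scale_sum_right)
  also have "\<dots> = (\<Sum>p\<in>{N..M}. \<Sum>n\<in>{N..M}. scl V (?w n * fls_nth (bracket_series h p) n) (Ycoeff V a p c))"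
    by (rule sum.swap)
  also have "\<dots> = (\<Sum>p\<in>{N..M}. scl V (pow1m_coeff (- h - p) (q - p)) (Ycoeff V a p c))"
    by (rule sum.cong[OF refl]) (simp add: P scale_sum_left)
  finally show ?thesis .
qed

end

section \<open>The Jacobi identity for \<open>X(a, x)\<close>\<close>

lemma pow1m_coeff_neg [simp]: "j < 0 \<Longrightarrow> pow1m_coeff n j = 0"
  by (simp add: pow1m_coeff_def)

lemma pow1m_coeff_of_nat: "pow1m_coeff n (int j) = (- 1) ^ j * (of_int n gchoose j)"
  by (simp add: pow1m_coeff_def)

text \<open>
  The identity \<open>(1 - z)\<^sup>a (1 - z)\<^sup>b = (1 - z)\<^sup>a\<^sup>+\<^sup>b\<close>.
\<close>

lemma pow1m_coeff_vandermonde: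
  assumes "n \<le> int K"
  shows "(\<Sum>j\<in>{..K}. pow1m_coeff a (int j) * pow1m_coeff b (n - int j)) = pow1m_coeff (a + b) n"
proof -
  have "fexp log1m \<noteq> 0"
  proof -
    have "fls_nth (fexp log1m) 0 = 1" by (simp add: fexp_def exp_log1m)
    then show ?thesis by force
  qed
  then have "fexp log1m powi a * fexp log1m powi b = fexp log1m powi (a + b)"
    by (simp add: power_int_add)
  moreover have "fls_nth (fexp log1m powi a * fexp log1m powi b) n =
      (\<Sum>j\<in>{..K}. pow1m_coeff a (int j) * pow1m_coeff b (n - int j))"
    unfolding fexp_log1m_power_int[of a]
    by (subst fls_times_fps_nth[where K = K]) (use assms in \<open>auto simp: fls_nth_exp_log1m_powi pow1m_coeff_of_nat\<close>)
  ultimately show ?thesis by (simp add: fls_nth_exp_log1m_powi)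
qed

context vertex_operator_algebra
begin

text \<open>
  The sums that arise from the two products and from the iterate. The binomial coefficients are a
  parameter \<open>k\<close>, so that finiteness and additivity are proved once for both orders of the product.
\<close>

definition mode_sum :: "(nat \<Rightarrow> complex) \<Rightarrow> 'v \<Rightarrow> int \<Rightarrow> 'v \<Rightarrow> int \<Rightarrow> 'v \<Rightarrow> 'v" where
  "mode_sum k a q b r c = Sum_any (\<lambda>j. scl V (k j) (Xcoeff V a (q + int j) (Xcoeff V b (r - int j) c)))"

definition bracket_sum :: "(nat \<Rightarrow> complex) \<Rightarrow> 'v \<Rightarrow> int \<Rightarrow> 'v \<Rightarrow> int \<Rightarrow> 'v \<Rightarrow> 'v" where
  "bracket_sum k a p b r c = Sum_any (\<lambda>j. scl V (k j) (Xcoeff V (log_bracket a (p - int j) b) r c))"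

lemmas Xcoeff_add = op_family_add[OF op_family_Xcoeff]
lemmas Xcoeff_scl = op_family_scl[OF op_family_Xcoeff]
lemmas Xcoeff_0 = op_family_0[OF op_family_Xcoeff]

lemma finite_mode_sum: "finite {j. scl V (k j) (Xcoeff V a (q + int j) (Xcoeff V b (r - int j) c)) \<noteq> 0}"
proof -
  obtain N where N: "\<And>n. n < N \<Longrightarrow> Xcoeff V b n c = 0"
    using op_family_truncation[OF op_family_Xcoeff] by meson
  have "{j. scl V (k j) (Xcoeff V a (q + int j) (Xcoeff V b (r - int j) c)) \<noteq> 0} \<subseteq> {..nat (r - N)}"
  proof
    fix j assume "j \<in> {j. scl V (k j) (Xcoeff V a (q + int j) (Xcoeff V b (r - int j) c)) \<noteq> 0}"
    then have "\<not> r - int j < N" using N Xcoeff_0 by auto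
    then show "j \<in> {..nat (r - N)}" by simp
  qed
  then show ?thesis by (rule finite_subset) simp
qed

lemma mode_sum_add:
  "mode_sum k (a + a') q b r c = mode_sum k a q b r c + mode_sum k a' q b r c"
  "mode_sum k a q (b + b') r c = mode_sum k a q b r c + mode_sum k a q b' r c"
  unfolding mode_sum_def
  by (simp_all only: Sum_any.distrib[OF finite_mode_sum finite_mode_sum, symmetric] Xcoeff_add scale_right_distrib)

lemma finite_bracket_sum: "finite {j. scl V (k j) (Xcoeff V (log_bracket a (p - int j) b) r c) \<noteq> 0}"
proof -
  obtain N where N: "\<And>q. q < N \<Longrightarrow> log_bracket a q b = 0"
    using log_bracket_truncation by meson
  have "{j. scl V (k j) (Xcoeff V (log_bracket a (p - int j) b) r c) \<noteq> 0} \<subseteq> {..nat (p - N)}"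
  proof
    fix j assume "j \<in> {j. scl V (k j) (Xcoeff V (log_bracket a (p - int j) b) r c) \<noteq> 0}"
    then have "\<not> p - int j < N" using N Xcoeff_0 by auto
    then show "j \<in> {..nat (p - N)}" by simp
  qed
  then show ?thesis by (rule finite_subset) simp
qed

lemma bracket_sum_add:
  "bracket_sum k (a + a') p b r c = bracket_sum k a p b r c + bracket_sum k a' p b r c"
  "bracket_sum k a p (b + b') r c = bracket_sum k a p b r c + bracket_sum k a p b' r c"
  unfolding bracket_sum_def
  by (simp_all only: Sum_any.distrib[OF finite_bracket_sum finite_bracket_sum, symmetric]
      log_bracket_add Xcoeff_add scale_right_distrib)

text \<open>
  The replacement of \<open>x\<^sub>2\<close> by \<open>x\<^sub>1 - x\<^sub>0\<close> under the delta function. The vector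
  \<open>y\<^sub>s\<close>, to which the coefficient of \<open>x\<^sub>0\<^sup>s\<close> in \<open>Y(a, x\<^sub>0)b\<close> contributes, is multiplied by a
  coefficient of \<open>(1 - z)\<^sup>q\<^sup>+\<^sup>p\<close>, from the delta function, and by a coefficient of \<open>(1 - z)\<^sup>-\<^sup>h\<^sup>-\<^sup>s\<close>, from the
  substitution of the logarithm. Summation over the ways to distribute the degree \<open>p - s\<close> gives a
  coefficient of \<open>(1 - z)\<^sup>q\<^sup>+\<^sup>p\<^sup>-\<^sup>h\<^sup>-\<^sup>s\<close>, and \<open>j = p - s\<close> turns it into the one in the Jacobi
  identity for \<open>a, b\<close> at the exponents \<open>p, q - h, r - g\<close>.
\<close>

lemma bracket_sum_homogeneous:
  assumes a: "a \<in> grade V h" and b: "b \<in> grade V g"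
  shows "bracket_sum (\<lambda>j. (- 1) ^ j * (of_int (q + p) gchoose j)) a p b (r + 1 + (q + p)) c =
    Sum_any (\<lambda>j::nat. scl V ((- 1) ^ j * (of_int (q - h + int j) gchoose j))
       (Ycoeff V (Ycoeff V a (p - int j) b) (r - g + 1 + (q - h + int j)) c))" (is "?L = Sum_any ?R")
proof -
  obtain N where N: "\<And>s. s < N \<Longrightarrow> Ycoeff V a s b = 0"
    using Ycoeff_truncation by meson
  define J where "J = nat (p - N)"
  define y where "y = (\<lambda>s. Ycoeff V (Ycoeff V a s b) (r + 1 + (q + p) - (h + g + s)) c)"
  have X: "Xcoeff V (sum (\<lambda>s. scl V (k s) (Ycoeff V a s b)) S) (r + 1 + (q + p)) c = (\<Sum>s\<in>S. scl V (k s) (y s))"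
    if "finite S" for k S
    using that
    by (induction S rule: finite_induct)
      (simp_all add: Xcoeff_0 Xcoeff_add Xcoeff_scl Xcoeff_homogeneous[OF Ycoeff_grade[OF a b]] y_def)
  have T: "scl V ((- 1) ^ j * (of_int (q + p) gchoose j)) (Xcoeff V (log_bracket a (p - int j) b) (r + 1 + (q + p)) c)
      = (\<Sum>s\<in>{N..p}. scl V (pow1m_coeff (q + p) (int j) * pow1m_coeff (- h - s) (p - s - int j)) (y s))" for j
  proof -
    have "log_bracket a (p - int j) b =
        (\<Sum>s\<in>{N..p}. scl V (pow1m_coeff (- h - s) (p - s - int j)) (Ycoeff V a s b))"
      by (subst log_bracket_homogeneous[OF a N, where M = p]) (simp_all add: algebra_simps)
    then show ?thesis
      by (simp only: X[OF finite_atLeastAtMost_int] scale_sum_right scale_scale pow1m_coeff_of_nat)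
  qed
  have "?L = (\<Sum>j\<in>{..J}. \<Sum>s\<in>{N..p}. scl V (pow1m_coeff (q + p) (int j) * pow1m_coeff (- h - s) (p - s - int j)) (y s))"
    unfolding bracket_sum_def T
  proof (rule Sum_any.expand_superset)
    show "{j. (\<Sum>s\<in>{N..p}. scl V (pow1m_coeff (q + p) (int j) * pow1m_coeff (- h - s) (p - s - int j)) (y s)) \<noteq> 0} \<subseteq> {..J}"
    proof (rule subsetI, rule ccontr)
      fix j assume "j \<in> {j. (\<Sum>s\<in>{N..p}. scl V (pow1m_coeff (q + p) (int j) * pow1m_coeff (- h - s) (p - s - int j)) (y s)) \<noteq> 0}"
        and "j \<notin> {..J}"
      moreover from this have "p - s - int j < 0" if "s \<in> {N..p}" for s
        using that by (auto simp: J_def)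
      ultimately show False by simp
    qed
  qed simp
  also have "\<dots> = (\<Sum>s\<in>{N..p}. \<Sum>j\<in>{..J}. scl V (pow1m_coeff (q + p) (int j) * pow1m_coeff (- h - s) (p - s - int j)) (y s))"
    by (rule sum.swap)
  also have "\<dots> = (\<Sum>s\<in>{N..p}. scl V (pow1m_coeff (q + p + (- h - s)) (p - s)) (y s))"
    by (rule sum.cong[OF refl], subst pow1m_coeff_vandermonde[where K = J, symmetric])
      (auto simp: J_def scale_sum_left)
  also have "\<dots> = (\<Sum>j\<in>{j. int j \<le> p - N}. ?R j)"
    by (rule sum.reindex_bij_witness[of _ "\<lambda>j. p - int j" "\<lambda>s. nat (p - s)"])
      (auto simp: pow1m_coeff_def y_def algebra_simps)
  also have "\<dots> = Sum_any ?R"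
  proof (rule Sum_any.expand_superset[symmetric])
    show "finite {j. int j \<le> p - N}"
      by (rule finite_subset[of _ "{..nat (p - N)}"]) auto
    show "{j. ?R j \<noteq> 0} \<subseteq> {j. int j \<le> p - N}"
    proof
      fix j assume "j \<in> {j. ?R j \<noteq> 0}"
      then have "\<not> p - int j < N" using N by auto
      then show "j \<in> {j. int j \<le> p - N}" by simp
    qed
  qed
  finally show ?thesis .
qed

text \<open>
  For homogeneous \<open>a, b\<close> this is the Jacobi identity multiplied by \<open>x\<^sub>1\<^sup>h x\<^sub>2\<^sup>g\<close>, that is,
  \<open>borcherds_identity\<close> at shifted exponents.
\<close>

lemma Xcoeff_jacobi:
  "mode_sum (\<lambda>j. (- 1) ^ j * (of_int (- p - 1) gchoose j)) a (q + p + 1) b r c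
   - mode_sum (\<lambda>j. (- 1) powi (- p - 1) * ((- 1) ^ j * (of_int (- p - 1) gchoose j))) b (r + p + 1) a q c
   = bracket_sum (\<lambda>j. (- 1) ^ j * (of_int (q + p) gchoose j)) a p b (r + 1 + (q + p)) c"
proof (induction a arbitrary: b rule: grade_induct)
  case (homogeneous h a)
  note a = homogeneous
  show ?case
  proof (induction b rule: grade_induct)
    case (homogeneous g b)
    show ?case
      unfolding mode_sum_def bracket_sum_homogeneous[OF a homogeneous]
        Xcoeff_homogeneous[OF a] Xcoeff_homogeneous[OF homogeneous]
        borcherds_identity[of p a "q - h" b "r - g" c, symmetric]
      by (simp add: algebra_simps)
  next
    case (add b b')
    then show ?case
      unfolding mode_sum_add bracket_sum_add by (simp add: algebra_simps)
  qed
next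
  case (add a a')
  from add(1)[of b] add(2)[of b] show ?case
    unfolding mode_sum_add bracket_sum_add by (simp add: algebra_simps)
qed

section \<open>The theorem\<close>

text \<open>
  The variable \<open>w\<close> is auxiliary: it allows the powers of \<open>y\<close> to be read as those of \<open>e\<^sup>t\<^sup>w y\<close> with \<open>t = 0\<close>.
\<close>

lemma involves_only_brk:
  assumes "y \<noteq> w"
  shows "involves_only {y} (brk V (vconst u) (fmono y) (vconst v))"
proof -
  have S: "subst_op V (Bcoeff V) (vconst u) (fmono y) m c =
      scl V (exp_coeff 0 (m y) (m w)) (Bcoeff V (vconst u (m(y := 0, w := 0))) (m y) c)" for m c
    unfolding fmono_evar[OF assms]
    by (rule subst_op_evar[OF assms]) (auto simp: vconst_def Bcoeff_0 split: if_splits)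
  have v0: "vconst v k = (if k = (\<lambda>_. 0) then v else 0)" for k
    by (simp add: vconst_def)
  have A: "brk V (vconst u) (fmono y) (vconst v) m = subst_op V (Bcoeff V) (vconst u) (fmono y) m v" for m
  proof -
    have "brk V (vconst u) (fmono y) (vconst v) m = subst_op V (Bcoeff V) (vconst u) (fmono y) (m - (\<lambda>_. 0)) v"
      unfolding brk_def app_op_def
      by (subst Sum_any_single[of "\<lambda>_. 0"]) (auto simp: v0 S Bcoeff_0)
    then show ?thesis by (simp add: fun_diff_def)
  qed
  show ?thesis
    unfolding involves_only_def
  proof (intro allI impI)
    fix m z assume "brk V (vconst u) (fmono y) (vconst v) m \<noteq> 0" and z: "z \<notin> {y}"
    then have "m w = 0" "vconst u (m(y := 0, w := 0)) \<noteq> 0"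
      by (auto simp: A S Bcoeff_0 exp_coeff_zero_left split: if_splits)
    then have "m w = 0" "\<forall>x. (m(y := 0, w := 0)) x = 0"
      by (auto simp: vconst_def fun_eq_iff split: if_splits)
    then show "m z = 0"
      using z by (cases "z = w") (auto split: if_splits)
  qed
qed

text \<open>
  The coefficients of \<open>Y[A, w\<^sub>0\<^sub>1]B\<close>. As \<open>w\<^sub>0\<^sub>1 = -log(1 - z)\<close> for the ratio \<open>z = x\<^sub>0 / (e\<^sup>w\<^sup>1 x\<^sub>1)\<close>, the powers of
  \<open>x\<^sub>0\<close> and \<open>e\<^sup>w\<^sup>1 x\<^sub>1\<close> have opposite exponents, and the exponents of \<open>y\<^sub>1\<close> and \<open>y\<^sub>2\<close> select the coefficients
  of \<open>A\<close> and \<open>B\<close>.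
\<close>

lemma brk_log:
  assumes A: "involves_only {Y1} A" and B: "involves_only {Y2} B"
  shows "brk V A (powers_of (fps_to_fls (- log1m)) (ratio (fmono X0) E1)) B m =
    scl V (exp_coeff 1 (m X1) (m W1)) (if m X1 = - 1 * m X0 \<and> m X2 = 0 \<and> m W2 = 0
      then log_bracket (A ((\<lambda>_. 0)(Y1 := m Y1))) (m X0) (B ((\<lambda>_. 0)(Y2 := m Y2))) else 0)"
proof -
  define Z where "Z = powers_of (fps_to_fls (- log1m)) (ratio (fmono X0) E1)"
  have Z: "Z n = eseries 1 (\<lambda>(p, q, r). if r = 0 \<and> p + q = 0 then fls_nth (neg_log1m_powi n) p else 0)" for n
    unfolding Z_def powers_of_def neg_log1m_powi_def[symmetric] by (rule fsubst_01)
  have Z0: "m z = 0" if "Z n m \<noteq> 0" "z = Y1 \<or> z = Y2" for n m z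
    using that(1)[unfolded Z] that(2) by (auto simp: eseries_def split: if_splits)
  have A0: "k = (\<lambda>_. 0)(Y1 := k Y1)" if "A k \<noteq> 0" for k
    using A that by (auto simp: involves_only_def fun_eq_iff)
  have B0: "k = (\<lambda>_. 0)(Y2 := k Y2)" if "B k \<noteq> 0" for k
    using B that by (auto simp: involves_only_def fun_eq_iff)
  have S: "subst_op V (Bcoeff V) A Z m c = (if m X1 = - 1 * m X0 \<and> m X2 = 0 \<and> m Y2 = 0
      then scl V (wcoeff 1 m) (log_bracket (A ((\<lambda>_. 0)(Y1 := m Y1))) (m X0) c) else 0)" for m c
  proof -
    let ?k = "(\<lambda>_. 0)(Y1 := m Y1) :: mono"
    have "subst_op V (Bcoeff V) A Z m c = Sum_any (\<lambda>n. scl V (Z n (m - ?k)) (Bcoeff V (A ?k) n c))"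
      unfolding subst_op_def
    proof (subst Sum_any_fst_single[of ?k])
      fix k n assume "k \<noteq> ?k"
      have "Z n (m - k) = 0 \<or> A k = 0"
      proof (rule ccontr)
        assume "\<not> ?thesis"
        then have "(m - k) Y1 = 0" "A k \<noteq> 0" using Z0[of n "m - k" Y1] by auto
        then have "k = ?k" using A0[of k] by simp
        with \<open>k \<noteq> ?k\<close> show False by simp
      qed
      then show "(case (k, n) of (k, n) \<Rightarrow> scl V (Z n (m - k)) (Bcoeff V (A k) n c)) = 0"
        by (auto simp: Bcoeff_0)
    qed simp
    also have "Z n (m - ?k) = (if m X1 = - 1 * m X0 \<and> m X2 = 0 \<and> m Y2 = 0
        then wcoeff 1 m * fls_nth (neg_log1m_powi n) (m X0) else 0)" for n
      unfolding Z by (auto simp: eseries_def exps_def wcoeff_def)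
    then have "Sum_any (\<lambda>n. scl V (Z n (m - ?k)) (Bcoeff V (A ?k) n c)) =
       (if m X1 = - 1 * m X0 \<and> m X2 = 0 \<and> m Y2 = 0
        then Sum_any (\<lambda>n. scl V (wcoeff 1 m) (scl V (fls_nth (neg_log1m_powi n) (m X0)) (Bcoeff V (A ?k) n c))) else 0)"
      by (cases "m X1 = - 1 * m X0 \<and> m X2 = 0 \<and> m Y2 = 0") auto
    finally show ?thesis
      unfolding Sum_any_scale log_bracket_def .
  qed
  let ?k = "(\<lambda>_. 0)(Y2 := m Y2) :: mono"
  have "brk V A Z B m = subst_op V (Bcoeff V) A Z (m - ?k) (B ?k)"
    unfolding brk_def app_op_def
  proof (rule Sum_any_single)
    fix k assume "k \<noteq> ?k"
    have "(m - k) Y2 \<noteq> 0 \<or> B k = 0"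
      using B0[of k] \<open>k \<noteq> ?k\<close> by auto
    then show "subst_op V (Bcoeff V) A Z (m - k) (B k) = 0"
      by (auto simp: S log_bracket_0)
  qed
  then have "brk V A Z B m = scl V (exp_coeff 1 (m X1) (m W1)) (if m X1 = - 1 * m X0 \<and> m X2 = 0 \<and> m W2 = 0
      then log_bracket (A ((\<lambda>_. 0)(Y1 := m Y1))) (m X0) (B ((\<lambda>_. 0)(Y2 := m Y2))) else 0)"
    by (auto simp: S wcoeff_def exp_coeff_zero)
  then show ?thesis unfolding Z_def .
qed

end

theorem theorem3p2:
  fixes V :: "'v::ab_group_add voa_data"
    and u1 v1 u2 v2 :: 'v
  assumes "vertex_operator_algebra V"
  shows
    "let A1 = brk V (vconst u1) (fmono Y1) (vconst v1);
         A2 = brk V (vconst u2) (fmono Y2) (vconst v2);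
         exp_w21 = powers_of (fexp log1m) (ratio E2 E1);
         neg_exp_w12 = powers_of (- fexp log1m) (ratio E1 E2);
         w01 = powers_of (fps_to_fls (- log1m)) (ratio (fmono X0) E1);
         exp_neg_w01 = powers_of (fexp (- (- log1m))) (ratio (fmono X0) E1)
     in
       scale_op V
         (fmono X0 (- 1) \<star> fdelta (\<lambda>n. exp_w21 n \<star> ratio E1 (fmono X0) n))
         (Xop V A1 E1 \<odot> Xop V A2 E2)
       - scale_op V
         (fmono X0 (- 1) \<star> fdelta (\<lambda>n. neg_exp_w12 n \<star> ratio E2 (fmono X0) n))
         (Xop V A2 E2 \<odot> Xop V A1 E1)
       = scale_op V
         (E2 (- 1) \<star> fdelta (\<lambda>n. exp_neg_w01 n \<star> ratio E1 E2 n))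
         (Xop V (brk V A1 w01 A2) E2)"
proof -
  interpret vertex_operator_algebra V by fact
  define A where "A = brk V (vconst u1) (fmono Y1) (vconst v1)"
  define B where "B = brk V (vconst u2) (fmono Y2) (vconst v2)"
  define C where "C = brk V A (powers_of (fps_to_fls (- log1m)) (ratio (fmono X0) E1)) B"
  have A: "involves_only {Y1} A" and B: "involves_only {Y2} B"
    unfolding A_def B_def by (rule involves_only_brk[of _ W1], simp)+
  have C: "C m = scl V (exp_coeff 1 (m X1) (m W1)) (if m X1 = - 1 * m X0 \<and> m X2 = 0 \<and> m W2 = 0
      then log_bracket (A ((\<lambda>_. 0)(Y1 := m Y1))) (m X0) (B ((\<lambda>_. 0)(Y2 := m Y2))) else 0)" for m
    unfolding C_def by (rule brk_log[OF A B])
  have E: "E1 = evar 1 X1 W1" "E2 = evar 1 X2 W2"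
    by (simp_all add: E1_def E2_def emono_evar)
  have "scale_op V (eseries 1 delta01_coeff) (Xop V A E1 \<odot> Xop V B E2)
      - scale_op V (eseries 1 delta02_coeff) (Xop V B E2 \<odot> Xop V A E1)
      = scale_op V (eseries 1 delta12_coeff) (Xop V C E2)"
  proof (intro ext)
    fix m c
    let ?a = "A ((\<lambda>_. 0)(Y1 := m Y1))" and ?b = "B ((\<lambda>_. 0)(Y2 := m Y2))"
    have r: "restrict_mono {Y1} m = (\<lambda>_. 0)(Y1 := m Y1)" "restrict_mono {Y2} m = (\<lambda>_. 0)(Y2 := m Y2)"
      by (auto simp: restrict_mono_def)
    obtain N where N: "\<And>q. q < N \<Longrightarrow> log_bracket ?a q ?b = 0"
      using log_bracket_truncation by meson
    have 1: "scale_op V (eseries 1 delta01_coeff) (Xop V A E1 \<odot> Xop V B E2) m c = scl V (wcoeff 1 m)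
       (mode_sum (\<lambda>j. (- 1) ^ j * (of_int (- m X0 - 1) gchoose j)) ?a (m X1 + m X0 + 1) ?b (m X2) c)"
      unfolding Xop_def E mode_sum_def scale_op_delta01[OF op_family_Xcoeff A B] r ..
    have 2: "scale_op V (eseries 1 delta02_coeff) (Xop V B E2 \<odot> Xop V A E1) m c = scl V (wcoeff 1 m)
       (mode_sum (\<lambda>j. (- 1) powi (- m X0 - 1) * ((- 1) ^ j * (of_int (- m X0 - 1) gchoose j)))
          ?b (m X2 + m X0 + 1) ?a (m X1) c)"
      unfolding Xop_def E mode_sum_def scale_op_delta02[OF op_family_Xcoeff A B] r ..
    have s: "m X1 + int j - - 1 * (m X0 - int j) = m X1 + m X0" for j by simp
    have 3: "scale_op V (eseries 1 delta12_coeff) (Xop V C E2) m c = scl V (wcoeff 1 m)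
       (bracket_sum (\<lambda>j. (- 1) ^ j * (of_int (m X1 + m X0) gchoose j)) ?a (m X0) ?b (m X2 + 1 + (m X1 + m X0)) c)"
      unfolding Xop_def E(2) bracket_sum_def
      by (subst scale_op_delta12[where d = "- 1" and N = N
            and g = "\<lambda>p y1 y2. log_bracket (A ((\<lambda>_. 0)(Y1 := y1))) p (B ((\<lambda>_. 0)(Y2 := y2)))",
            OF op_family_Xcoeff C]) (simp_all only: N s)
    show "(scale_op V (eseries 1 delta01_coeff) (Xop V A E1 \<odot> Xop V B E2)
      - scale_op V (eseries 1 delta02_coeff) (Xop V B E2 \<odot> Xop V A E1)) m c
      = scale_op V (eseries 1 delta12_coeff) (Xop V C E2) m c"
      unfolding minus_apply 1 2 3 Xcoeff_jacobi[symmetric] by (rule scale_right_diff_distrib[symmetric])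
  qed
  then show ?thesis
    unfolding Let_def delta01_emono delta02_emono delta12_emono A_def B_def C_def .
qed

end
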